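(* Let $\mathcal{C}$ be a complete closed monoidal category with products. Then $\mathsf{Fam}(\mathcal{C})$ is closed monoidal, with internal hom defined as follows: for $\underline{Y}=(J,Y_j)$ and $\underline{Z}=(U,Z_u)$, $[\underline{Y},\underline{Z}]:=([J,U],[\underline{Y},\underline{Z}]_\alpha)$, where $[J,U]$ is the set of functions $J\to U$ and, for each function $\alpha:J\to U$, $[\underline{Y},\underline{Z}]_\alpha:=\prod_{j\in J}[Y_j,Z_{\alpha(j)}]$. Given a morphism $\underline{c}=(q:U\to U',\ z_u:Z_u\to Z'_{q(u)}):\underline{Z}\to\underline{Z}'$, the morphism $[\underline{Y},\underline{c}]:[\underline{Y},\underline{Z}]\to[\underline{Y},\underline{Z}']$ is $$[\underline{Y},\underline{c}]:=\Big([J,q]:[J,U]\to[J,U'],\ \prod_{j\in J}[Y_j,z_{\alpha(j)}]:[\underline{Y},\underline{Z}]_\alpha\to[\underline{Y},\underline{Z}']_{q\circ\alpha}\Big).$$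
   Context: A monoidal category $\mathcal{C}$ is closed (meaning right closed) if for every object $X$ the functor $(-)\otimes X:\mathcal{C}\to\mathcal{C}$ has a right adjoint $[X,-]:\mathcal{C}\to\mathcal{C}$, called the internal hom. $[J,q]$ is the map $\alpha\mapsto q\circ\alpha$. The category $\mathsf{Fam}(\mathcal{C})$: an object is a pair $\underline{X}=(I,X_i)$ where $I$ is a set and $X_i$ is an object of $\mathcal{C}$ for each $i\in I$. A morphism $(I,X_i)\to(J,Y_j)$ is a pair $(f,\phi_i)$ where $f:I\to J$ is a map and $\phi_i:X_i\to Y_{f(i)}$ is a morphism of $\mathcal{C}$ for each $i\in I$. If $(\mathcal{C},\otimes,\mathbb{I})$ is monoidal, so is $\mathsf{Fam}(\mathcal{C})$, with $(I,X_i)\otimes(J,Y_j)=(I\times J,X_i\otimes Y_j)$, $(f,\phi_i)\otimes(f',\phi'_{i'})=(f\times f',\phi_i\otimes\phi'_{i'})$, and unit object $(\{*\},\mathbb{I})$. *)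

theory Defs
  imports Main "HOL-Library.FuncSet"
begin

section \<open>Categories, functors, adjunctions\<close>

record ('o, 'm) category =
  Obj :: "'o set"
  Arr :: "'m set"
  Dom :: "'m \<Rightarrow> 'o"
  Cod :: "'m \<Rightarrow> 'o"
  Ident :: "'o \<Rightarrow> 'm"
  Comp :: "'m \<Rightarrow> 'm \<Rightarrow> 'm"  (* Comp C g f is g after f *)

definition hom :: "('o, 'm) category \<Rightarrow> 'o \<Rightarrow> 'o \<Rightarrow> 'm set" where
  "hom C X Y = {f \<in> Arr C. Dom C f = X \<and> Cod C f = Y}"

locale category =
  fixes C :: "('o, 'm) category"
  assumes dom_obj: "f \<in> Arr C \<Longrightarrow> Dom C f \<in> Obj C"
    and cod_obj: "f \<in> Arr C \<Longrightarrow> Cod C f \<in> Obj C"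
    and ident_hom: "X \<in> Obj C \<Longrightarrow> Ident C X \<in> hom C X X"
    and comp_hom: "f \<in> hom C X Y \<Longrightarrow> g \<in> hom C Y Z \<Longrightarrow> Comp C g f \<in> hom C X Z"
    and comp_assoc: "f \<in> hom C W X \<Longrightarrow> g \<in> hom C X Y \<Longrightarrow> h \<in> hom C Y Z \<Longrightarrow>
      Comp C h (Comp C g f) = Comp C (Comp C h g) f"
    and comp_ident_right: "f \<in> hom C X Y \<Longrightarrow> Comp C f (Ident C X) = f"
    and comp_ident_left: "f \<in> hom C X Y \<Longrightarrow> Comp C (Ident C Y) f = f"

definition is_iso :: "('o, 'm) category \<Rightarrow> 'm \<Rightarrow> bool" where
  "is_iso C f \<longleftrightarrow> f \<in> Arr C \<and>
    (\<exists>g \<in> hom C (Cod C f) (Dom C f).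
      Comp C g f = Ident C (Dom C f) \<and> Comp C f g = Ident C (Cod C f))"

record ('o, 'm, 'p, 'n) cat_functor =
  onobj :: "'o \<Rightarrow> 'p"
  onarr :: "'m \<Rightarrow> 'n"

locale cat_functor =
  source: category C + target: category D
  for C :: "('o, 'm) category" and D :: "('p, 'n) category" +
  fixes F :: "('o, 'm, 'p, 'n) cat_functor"
  assumes onobj: "X \<in> Obj C \<Longrightarrow> onobj F X \<in> Obj D"
    and onarr: "f \<in> hom C X Y \<Longrightarrow> onarr F f \<in> hom D (onobj F X) (onobj F Y)"
    and onarr_ident: "X \<in> Obj C \<Longrightarrow> onarr F (Ident C X) = Ident D (onobj F X)"
    and onarr_comp: "f \<in> hom C X Y \<Longrightarrow> g \<in> hom C Y Z \<Longrightarrow>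
      onarr F (Comp C g f) = Comp D (onarr F g) (onarr F f)"

definition prod_cat ::
  "('o, 'm) category \<Rightarrow> ('p, 'n) category \<Rightarrow> ('o \<times> 'p, 'm \<times> 'n) category" where
  "prod_cat C D =
    \<lparr> Obj = Obj C \<times> Obj D,
      Arr = Arr C \<times> Arr D,
      Dom = (\<lambda>(f, g). (Dom C f, Dom D g)),
      Cod = (\<lambda>(f, g). (Cod C f, Cod D g)),
      Ident = (\<lambda>(X, Y). (Ident C X, Ident D Y)),
      Comp = (\<lambda>(f', g') (f, g). (Comp C f' f, Comp D g' g)) \<rparr>"

locale adjunction =
  left: cat_functor C D F + right: cat_functor D C G
  for C :: "('o, 'm) category" and D :: "('p, 'n) category"
    and F :: "('o, 'm, 'p, 'n) cat_functor" and G :: "('p, 'n, 'o, 'm) cat_functor" +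
  fixes \<phi> :: "'o \<Rightarrow> 'p \<Rightarrow> 'n \<Rightarrow> 'm"
  assumes bij: "A \<in> Obj C \<Longrightarrow> B \<in> Obj D \<Longrightarrow>
      bij_betw (\<phi> A B) (hom D (onobj F A) B) (hom C A (onobj G B))"
    and natural: "f \<in> hom C A' A \<Longrightarrow> g \<in> hom D B B' \<Longrightarrow> h \<in> hom D (onobj F A) B \<Longrightarrow>
      \<phi> A' B' (Comp D g (Comp D h (onarr F f))) = Comp C (onarr G g) (Comp C (\<phi> A B h) f)"

definition is_right_adjoint ::
  "('o, 'm) category \<Rightarrow> ('p, 'n) category \<Rightarrow>
   ('o, 'm, 'p, 'n) cat_functor \<Rightarrow> ('p, 'n, 'o, 'm) cat_functor \<Rightarrow> bool" where
  "is_right_adjoint C D F G \<longleftrightarrow> (\<exists>\<phi>. adjunction C D F G \<phi>)"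


section \<open>Closed monoidal categories\<close>

record ('o, 'm) monoidal =
  cat :: "('o, 'm) category"
  tensor :: "('o \<times> 'o, 'm \<times> 'm, 'o, 'm) cat_functor"
  unit_obj :: 'o
  assoc :: "'o \<Rightarrow> 'o \<Rightarrow> 'o \<Rightarrow> 'm"
  lunit :: "'o \<Rightarrow> 'm"
  runit :: "'o \<Rightarrow> 'm"

abbreviation tens_obj :: "('o, 'm) monoidal \<Rightarrow> 'o \<Rightarrow> 'o \<Rightarrow> 'o" where
  "tens_obj M X Y \<equiv> onobj (tensor M) (X, Y)"

abbreviation tens_arr :: "('o, 'm) monoidal \<Rightarrow> 'm \<Rightarrow> 'm \<Rightarrow> 'm" where
  "tens_arr M f g \<equiv> onarr (tensor M) (f, g)"

locale monoidal_category =
  category "cat M" + tensor: cat_functor "prod_cat (cat M) (cat M)" "cat M" "tensor M"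
  for M :: "('o, 'm) monoidal" +
  assumes unit_obj: "unit_obj M \<in> Obj (cat M)"
    and assoc_hom: "X \<in> Obj (cat M) \<Longrightarrow> Y \<in> Obj (cat M) \<Longrightarrow> Z \<in> Obj (cat M) \<Longrightarrow>
      assoc M X Y Z \<in> hom (cat M) (tens_obj M (tens_obj M X Y) Z) (tens_obj M X (tens_obj M Y Z))"
    and assoc_iso: "X \<in> Obj (cat M) \<Longrightarrow> Y \<in> Obj (cat M) \<Longrightarrow> Z \<in> Obj (cat M) \<Longrightarrow>
      is_iso (cat M) (assoc M X Y Z)"
    and assoc_natural:
      "f \<in> hom (cat M) X X' \<Longrightarrow> g \<in> hom (cat M) Y Y' \<Longrightarrow> h \<in> hom (cat M) Z Z' \<Longrightarrow>
       Comp (cat M) (assoc M X' Y' Z') (tens_arr M (tens_arr M f g) h) =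
       Comp (cat M) (tens_arr M f (tens_arr M g h)) (assoc M X Y Z)"
    and lunit_hom: "X \<in> Obj (cat M) \<Longrightarrow> lunit M X \<in> hom (cat M) (tens_obj M (unit_obj M) X) X"
    and lunit_iso: "X \<in> Obj (cat M) \<Longrightarrow> is_iso (cat M) (lunit M X)"
    and lunit_natural: "f \<in> hom (cat M) X Y \<Longrightarrow>
       Comp (cat M) (lunit M Y) (tens_arr M (Ident (cat M) (unit_obj M)) f) =
       Comp (cat M) f (lunit M X)"
    and runit_hom: "X \<in> Obj (cat M) \<Longrightarrow> runit M X \<in> hom (cat M) (tens_obj M X (unit_obj M)) X"
    and runit_iso: "X \<in> Obj (cat M) \<Longrightarrow> is_iso (cat M) (runit M X)"
    and runit_natural: "f \<in> hom (cat M) X Y \<Longrightarrow>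
       Comp (cat M) (runit M Y) (tens_arr M f (Ident (cat M) (unit_obj M))) =
       Comp (cat M) f (runit M X)"
    and triangle: "X \<in> Obj (cat M) \<Longrightarrow> Y \<in> Obj (cat M) \<Longrightarrow>
       Comp (cat M) (tens_arr M (Ident (cat M) X) (lunit M Y)) (assoc M X (unit_obj M) Y) =
       tens_arr M (runit M X) (Ident (cat M) Y)"
    and pentagon:
      "W \<in> Obj (cat M) \<Longrightarrow> X \<in> Obj (cat M) \<Longrightarrow> Y \<in> Obj (cat M) \<Longrightarrow> Z \<in> Obj (cat M) \<Longrightarrow>
       Comp (cat M) (tens_arr M (Ident (cat M) W) (assoc M X Y Z))
         (Comp (cat M) (assoc M W (tens_obj M X Y) Z)
           (tens_arr M (assoc M W X Y) (Ident (cat M) Z))) =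
       Comp (cat M) (assoc M W X (tens_obj M Y Z)) (assoc M (tens_obj M W X) Y Z)"

definition tensor_right :: "('o, 'm) monoidal \<Rightarrow> 'o \<Rightarrow> ('o, 'm, 'o, 'm) cat_functor" where
  "tensor_right M X =
    \<lparr> onobj = (\<lambda>A. tens_obj M A X), onarr = (\<lambda>f. tens_arr M f (Ident (cat M) X)) \<rparr>"

text \<open>\<open>H X\<close> is the internal hom functor \<open>[X, -]\<close>.\<close>

locale closed_monoidal_category =
  monoidal_category M
  for M :: "('o, 'm) monoidal" +
  fixes H :: "'o \<Rightarrow> ('o, 'm, 'o, 'm) cat_functor"
  assumes internal_hom: "X \<in> Obj (cat M) \<Longrightarrow>
    is_right_adjoint (cat M) (cat M) (tensor_right M X) (H X)"


section \<open>A universe of sets\<close>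

text \<open>
  The sets of the informal development have to be closed under products and function sets,
  which the subsets of one fixed HOL type are not (a product of two of them lives in another
  type). They are therefore taken from an arbitrary Grothendieck universe: a type whose
  elements \<open>x\<close> stand for small sets \<open>elts x\<close> of elements of the same type.
  Infinity and foundation are not assumed.
\<close>

class set_universe =
  fixes elts :: "'a \<Rightarrow> 'a set"
  assumes elts_inject: "elts x = elts y \<Longrightarrow> x = y"
    and elts_separation: "A \<subseteq> elts x \<Longrightarrow> \<exists>z. elts z = A"
    and elts_pairing: "\<exists>z. elts z = {x, y}"
    and elts_union: "\<exists>z. elts z = (\<Union>y \<in> elts x. elts y)"
    and elts_power: "\<exists>z. elts z = {y. elts y \<subseteq> elts x}"
    and elts_replacement: "\<exists>z. elts z = f ` elts x"

definition small :: "'v::set_universe set \<Rightarrow> bool" where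
  "small A \<longleftrightarrow> A \<in> range elts"

definition enc :: "'v::set_universe set \<Rightarrow> 'v" where
  "enc A = (THE x. elts x = A)"

text \<open>Kuratowski pairs, and functions as their graphs.\<close>

definition pair :: "'v::set_universe \<Rightarrow> 'v \<Rightarrow> 'v" where
  "pair a b = enc {enc {a}, enc {a, b}}"

definition pfst :: "'v::set_universe \<Rightarrow> 'v" where
  "pfst p = (THE a. \<exists>b. p = pair a b)"

definition psnd :: "'v::set_universe \<Rightarrow> 'v" where
  "psnd p = (THE b. \<exists>a. p = pair a b)"

definition times_set :: "'v::set_universe set \<Rightarrow> 'v set \<Rightarrow> 'v set" where
  "times_set I J = {pair i j | i j. i \<in> I \<and> j \<in> J}"

definition graph :: "'v::set_universe set \<Rightarrow> ('v \<Rightarrow> 'v) \<Rightarrow> 'v" where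
  "graph J \<alpha> = enc {pair j (\<alpha> j) | j. j \<in> J}"

definition app :: "'v::set_universe \<Rightarrow> 'v \<Rightarrow> 'v" where
  "app a j = (THE u. pair j u \<in> elts a)"

definition fun_set :: "'v::set_universe set \<Rightarrow> 'v set \<Rightarrow> 'v set" where
  "fun_set J U = {graph J \<alpha> | \<alpha>. \<alpha> \<in> J \<rightarrow> U}"


section \<open>Limits and products\<close>

definition is_cone ::
  "('j, 'k) category \<Rightarrow> ('o, 'm) category \<Rightarrow> ('j, 'k, 'o, 'm) cat_functor \<Rightarrow>
   'o \<Rightarrow> ('j \<Rightarrow> 'm) \<Rightarrow> bool" where
  "is_cone D C F A \<tau> \<longleftrightarrow> A \<in> Obj C \<and>
    (\<forall>j \<in> Obj D. \<tau> j \<in> hom C A (onobj F j)) \<and>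
    (\<forall>d \<in> Arr D. Comp C (onarr F d) (\<tau> (Dom D d)) = \<tau> (Cod D d))"

definition is_limit ::
  "('j, 'k) category \<Rightarrow> ('o, 'm) category \<Rightarrow> ('j, 'k, 'o, 'm) cat_functor \<Rightarrow>
   'o \<Rightarrow> ('j \<Rightarrow> 'm) \<Rightarrow> bool" where
  "is_limit D C F L \<pi> \<longleftrightarrow> is_cone D C F L \<pi> \<and>
    (\<forall>A \<tau>. is_cone D C F A \<tau> \<longrightarrow>
      (\<exists>!h. h \<in> hom C A L \<and> (\<forall>j \<in> Obj D. Comp C (\<pi> j) h = \<tau> j)))"

text \<open>The type argument names the universe with respect to which diagrams are small.\<close>

definition complete :: "'v::set_universe itself \<Rightarrow> ('o, 'm) category \<Rightarrow> bool" where
  "complete (_ :: 'v itself) C \<longleftrightarrow>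
    (\<forall>(D :: ('v, 'v) category) F.
      small (Obj D) \<and> small (Arr D) \<and> cat_functor D C F \<longrightarrow> (\<exists>L \<pi>. is_limit D C F L \<pi>))"

definition is_product ::
  "('o, 'm) category \<Rightarrow> 'j set \<Rightarrow> ('j \<Rightarrow> 'o) \<Rightarrow> 'o \<Rightarrow> ('j \<Rightarrow> 'm) \<Rightarrow> bool" where
  "is_product C J X P \<pi> \<longleftrightarrow> P \<in> Obj C \<and>
    (\<forall>j \<in> J. \<pi> j \<in> hom C P (X j)) \<and>
    (\<forall>A \<in> Obj C. \<forall>f. (\<forall>j \<in> J. f j \<in> hom C A (X j)) \<longrightarrow>
      (\<exists>!h. h \<in> hom C A P \<and> (\<forall>j \<in> J. Comp C (\<pi> j) h = f j)))"

record ('v, 'o, 'm) products =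
  pobj :: "'v set \<Rightarrow> ('v \<Rightarrow> 'o) \<Rightarrow> 'o"
  proj :: "'v set \<Rightarrow> ('v \<Rightarrow> 'o) \<Rightarrow> 'v \<Rightarrow> 'm"

definition has_products ::
  "('o, 'm) category \<Rightarrow> ('v::set_universe, 'o, 'm) products \<Rightarrow> bool" where
  "has_products C P \<longleftrightarrow>
    (\<forall>J. \<forall>X \<in> J \<rightarrow>\<^sub>E Obj C. small J \<longrightarrow> is_product C J X (pobj P J X) (proj P J X))"

definition prod_arr ::
  "('o, 'm) category \<Rightarrow> ('v, 'o, 'm) products \<Rightarrow>
   'v set \<Rightarrow> ('v \<Rightarrow> 'o) \<Rightarrow> ('v \<Rightarrow> 'o) \<Rightarrow> ('v \<Rightarrow> 'm) \<Rightarrow> 'm" where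
  "prod_arr C P J X X' f =
    (THE h. h \<in> hom C (pobj P J X) (pobj P J X') \<and>
      (\<forall>j \<in> J. Comp C (proj P J X' j) h = Comp C (f j) (proj P J X j)))"


section \<open>The category of families\<close>

text \<open>
  All functions occurring in objects and arrows are extensional (\<open>undefined\<close> outside the
  index set), so that equality in HOL is equality of families.
\<close>

record ('v, 'o) fam =
  index :: "'v set"
  fib :: "'v \<Rightarrow> 'o"

record ('v, 'o, 'm) fam_arr =
  src :: "('v, 'o) fam"
  tgt :: "('v, 'o) fam"
  imap :: "'v \<Rightarrow> 'v"
  comps :: "'v \<Rightarrow> 'm"

definition fam_obj :: "('o, 'm) category \<Rightarrow> ('v::set_universe, 'o) fam set" where
  "fam_obj C = {X. small (index X) \<and> fib X \<in> index X \<rightarrow>\<^sub>E Obj C}"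

definition Fam ::
  "('o, 'm) category \<Rightarrow> (('v::set_universe, 'o) fam, ('v, 'o, 'm) fam_arr) category" where
  "Fam C =
    \<lparr> Obj = fam_obj C,
      Arr = {f. src f \<in> fam_obj C \<and> tgt f \<in> fam_obj C \<and>
        imap f \<in> index (src f) \<rightarrow>\<^sub>E index (tgt f) \<and>
        comps f \<in> (\<Pi>\<^sub>E i \<in> index (src f). hom C (fib (src f) i) (fib (tgt f) (imap f i)))},
      Dom = src,
      Cod = tgt,
      Ident = (\<lambda>X. \<lparr> src = X, tgt = X,
        imap = (\<lambda>i \<in> index X. i),
        comps = (\<lambda>i \<in> index X. Ident C (fib X i)) \<rparr>),
      Comp = (\<lambda>g f. \<lparr> src = src f, tgt = tgt g,
        imap = (\<lambda>i \<in> index (src f). imap g (imap f i)),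
        comps = (\<lambda>i \<in> index (src f). Comp C (comps g (imap f i)) (comps f i)) \<rparr>) \<rparr>"

definition fam_tens_obj ::
  "('o, 'm) monoidal \<Rightarrow> ('v::set_universe, 'o) fam \<Rightarrow> ('v, 'o) fam \<Rightarrow> ('v, 'o) fam" where
  "fam_tens_obj M X Y =
    \<lparr> index = times_set (index X) (index Y),
      fib = (\<lambda>p \<in> times_set (index X) (index Y).
        tens_obj M (fib X (pfst p)) (fib Y (psnd p))) \<rparr>"

definition fam_tens_arr ::
  "('o, 'm) monoidal \<Rightarrow> ('v::set_universe, 'o, 'm) fam_arr \<Rightarrow> ('v, 'o, 'm) fam_arr \<Rightarrow>
   ('v, 'o, 'm) fam_arr" where
  "fam_tens_arr M f g =
    \<lparr> src = fam_tens_obj M (src f) (src g),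
      tgt = fam_tens_obj M (tgt f) (tgt g),
      imap = (\<lambda>p \<in> times_set (index (src f)) (index (src g)).
        pair (imap f (pfst p)) (imap g (psnd p))),
      comps = (\<lambda>p \<in> times_set (index (src f)) (index (src g)).
        tens_arr M (comps f (pfst p)) (comps g (psnd p))) \<rparr>"

definition fam_unit :: "('o, 'm) monoidal \<Rightarrow> ('v::set_universe, 'o) fam" where
  "fam_unit M = \<lparr> index = {enc {}}, fib = (\<lambda>i \<in> {enc {}}. unit_obj M) \<rparr>"

definition fam_assoc ::
  "('o, 'm) monoidal \<Rightarrow> ('v::set_universe, 'o) fam \<Rightarrow> ('v, 'o) fam \<Rightarrow> ('v, 'o) fam \<Rightarrow>
   ('v, 'o, 'm) fam_arr" where
  "fam_assoc M X Y Z =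
    \<lparr> src = fam_tens_obj M (fam_tens_obj M X Y) Z,
      tgt = fam_tens_obj M X (fam_tens_obj M Y Z),
      imap = (\<lambda>p \<in> times_set (times_set (index X) (index Y)) (index Z).
        pair (pfst (pfst p)) (pair (psnd (pfst p)) (psnd p))),
      comps = (\<lambda>p \<in> times_set (times_set (index X) (index Y)) (index Z).
        assoc M (fib X (pfst (pfst p))) (fib Y (psnd (pfst p))) (fib Z (psnd p))) \<rparr>"

definition fam_lunit ::
  "('o, 'm) monoidal \<Rightarrow> ('v::set_universe, 'o) fam \<Rightarrow> ('v, 'o, 'm) fam_arr" where
  "fam_lunit M X =
    \<lparr> src = fam_tens_obj M (fam_unit M) X,
      tgt = X,
      imap = (\<lambda>p \<in> times_set {enc {}} (index X). psnd p),
      comps = (\<lambda>p \<in> times_set {enc {}} (index X). lunit M (fib X (psnd p))) \<rparr>"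

definition fam_runit ::
  "('o, 'm) monoidal \<Rightarrow> ('v::set_universe, 'o) fam \<Rightarrow> ('v, 'o, 'm) fam_arr" where
  "fam_runit M X =
    \<lparr> src = fam_tens_obj M X (fam_unit M),
      tgt = X,
      imap = (\<lambda>p \<in> times_set (index X) {enc {}}. pfst p),
      comps = (\<lambda>p \<in> times_set (index X) {enc {}}. runit M (fib X (pfst p))) \<rparr>"

definition Fam_monoidal ::
  "('o, 'm) monoidal \<Rightarrow> (('v::set_universe, 'o) fam, ('v, 'o, 'm) fam_arr) monoidal" where
  "Fam_monoidal M =
    \<lparr> cat = Fam (cat M),
      tensor = \<lparr> onobj = (\<lambda>(X, Y). fam_tens_obj M X Y),
        onarr = (\<lambda>(f, g). fam_tens_arr M f g) \<rparr>,
      unit_obj = fam_unit M,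
      assoc = fam_assoc M,
      lunit = fam_lunit M,
      runit = fam_runit M \<rparr>"


section \<open>The internal hom of families\<close>

text \<open>
  The family \<open>j \<mapsto> [Y\<^sub>j, Z\<^bsub>\<alpha>(j)\<^esub>]\<close>, where \<open>\<alpha>\<close> is an element of \<open>fun_set\<close>, that is, a graph.
\<close>

definition ihom_factors ::
  "('o \<Rightarrow> ('o, 'm, 'o, 'm) cat_functor) \<Rightarrow> ('v::set_universe, 'o) fam \<Rightarrow> ('v, 'o) fam \<Rightarrow>
   'v \<Rightarrow> 'v \<Rightarrow> 'o" where
  "ihom_factors H Y Z \<alpha> = (\<lambda>j \<in> index Y. onobj (H (fib Y j)) (fib Z (app \<alpha> j)))"

definition fam_ihom_obj ::
  "('o \<Rightarrow> ('o, 'm, 'o, 'm) cat_functor) \<Rightarrow> ('v::set_universe, 'o, 'm) products \<Rightarrow>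
   ('v, 'o) fam \<Rightarrow> ('v, 'o) fam \<Rightarrow> ('v, 'o) fam" where
  "fam_ihom_obj H P Y Z =
    \<lparr> index = fun_set (index Y) (index Z),
      fib = (\<lambda>\<alpha> \<in> fun_set (index Y) (index Z).
        pobj P (index Y) (ihom_factors H Y Z \<alpha>)) \<rparr>"

definition fam_ihom_imap ::
  "('v::set_universe, 'o) fam \<Rightarrow> ('v, 'o, 'm) fam_arr \<Rightarrow> 'v \<Rightarrow> 'v" where
  "fam_ihom_imap Y c = (\<lambda>\<alpha> \<in> fun_set (index Y) (index (src c)).
    graph (index Y) (imap c \<circ> app \<alpha>))"

definition fam_ihom_arr ::
  "('o, 'm) category \<Rightarrow> ('o \<Rightarrow> ('o, 'm, 'o, 'm) cat_functor) \<Rightarrow>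
   ('v::set_universe, 'o, 'm) products \<Rightarrow>
   ('v, 'o) fam \<Rightarrow> ('v, 'o, 'm) fam_arr \<Rightarrow> ('v, 'o, 'm) fam_arr" where
  "fam_ihom_arr C H P Y c =
    \<lparr> src = fam_ihom_obj H P Y (src c),
      tgt = fam_ihom_obj H P Y (tgt c),
      imap = fam_ihom_imap Y c,
      comps = (\<lambda>\<alpha> \<in> fun_set (index Y) (index (src c)).
        prod_arr C P (index Y)
          (ihom_factors H Y (src c) \<alpha>)
          (ihom_factors H Y (tgt c) (fam_ihom_imap Y c \<alpha>))
          (\<lambda>j. onarr (H (fib Y j)) (comps c (app \<alpha> j)))) \<rparr>"

definition Fam_ihom ::
  "('o, 'm) category \<Rightarrow> ('o \<Rightarrow> ('o, 'm, 'o, 'm) cat_functor) \<Rightarrow>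
   ('v::set_universe, 'o, 'm) products \<Rightarrow> ('v, 'o) fam \<Rightarrow>
   (('v, 'o) fam, ('v, 'o, 'm) fam_arr, ('v, 'o) fam, ('v, 'o, 'm) fam_arr) cat_functor" where
  "Fam_ihom C H P Y =
    \<lparr> onobj = fam_ihom_obj H P Y, onarr = fam_ihom_arr C H P Y \<rparr>"

end

theory Submission imports Defs begin

text \<open>
  The coherence laws of the tensor product of families hold componentwise. An arrow
  \<open>A \<rightarrow> [Y, Z]\<close> amounts to elements \<open>m(i, j)\<close> of the index set of \<open>Z\<close> together with arrows
  \<open>A\<^sub>i \<rightarrow> [Y\<^sub>j, Z\<^bsub>m(i,j)\<^esub>]\<close> of \<open>C\<close>, by the universal properties of the function set and of the
  product. Transposing each of the latter in \<open>C\<close> gives arrows \<open>A\<^sub>i \<otimes> Y\<^sub>j \<rightarrow> Z\<^bsub>m(i,j)\<^esub>\<close>, that is,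
  an arrow \<open>A \<otimes> Y \<rightarrow> Z\<close>.
\<close>

section \<open>Small sets\<close>

text \<open>The formula for \<open>[Y, Z]\<close> is distributivity: for fixed \<open>i\<close>, an
  arrow of families chooses for every \<open>j\<close> some \<open>u\<close> and an arrow into the
  fibre over \<open>u\<close>, and a product over \<open>j\<close> of disjoint unions over
  \<open>u\<close> is a disjoint union over functions \<alpha> of products over \<open>j\<close>.
  The functions become indices and the products become fibres.

  The obstacle is dependency. The fibre of \<open>[Y, Z]\<close> over \<alpha>, hence the codomain
  of a component, varies with \<alpha>, which is itself only the code of a graph; comparing arrows
  into \<open>[Y, Z]\<close> directly would mix codes, definite descriptions and products. Such an
  arrow \<open>k\<close> is therefore seen only through its coordinates
  \<open>app (imap k i) j\<close> and \<open>coord Y Z k i j\<close>: \<open>fam_lam\<close> builds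
  an arrow from coordinates, and \<open>fam_ihom_eqI\<close> says that they determine it. Since
  \<open>[Y, c]\<close> is itself a \<open>fam_lam\<close>, functoriality and naturality become
  equations between coordinates, each of them a fact about \<open>H\<close> or about the adjunctions
  in the base category.\<close>

lemma small_elts [simp]: "small (elts x)"
  by (simp add: small_def)

lemma enc_elts [simp]: "enc (elts x) = x"
  unfolding enc_def by (rule the_equality) (auto intro: elts_inject)

lemma elts_enc: "small A \<Longrightarrow> elts (enc A) = A"
  by (auto simp: small_def)

lemma enc_eq_iff: "small A \<Longrightarrow> small B \<Longrightarrow> enc A = enc B \<longleftrightarrow> A = B"
  by (metis elts_enc)

lemma small_subset: "small B \<Longrightarrow> A \<subseteq> B \<Longrightarrow> small A"
  by (auto simp: small_def image_iff dest: elts_separation)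

lemma small_doubleton [simp]: "small {x, y}"
  using elts_pairing[of x y] by (auto simp: small_def)

lemma small_singleton [simp]: "small {x}"
  using small_doubleton[of x x] by simp

lemma small_image:
  fixes f :: "'v::set_universe \<Rightarrow> 'v"
  assumes "small A"
  shows "small (f ` A)"
  using elts_replacement[of f "enc A"] elts_enc[OF assms] by (metis small_elts)

text \<open>The union axiom speaks of elements of the universe, not of HOL sets. Each
  \<open>B a\<close> is therefore replaced by its code, and replacement makes the set of codes
  small.\<close>

lemma small_UN:
  fixes A :: "'v::set_universe set" and B :: "'v \<Rightarrow> 'v set"
  assumes "small A" "\<And>a. a \<in> A \<Longrightarrow> small (B a)"
  shows "small (\<Union>a\<in>A. B a)"
proof -
  let ?x = "enc ((\<lambda>a. enc (B a)) ` A)"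
  have "(\<Union>a\<in>A. B a) = (\<Union>y\<in>elts ?x. elts y)"
    using assms by (simp add: elts_enc small_image)
  then show ?thesis
    using elts_union[of ?x] by (metis small_elts)
qed

lemma pair_eq_iff [simp]: "pair a b = pair c d \<longleftrightarrow> a = c \<and> b = d"
  by (auto simp: pair_def enc_eq_iff doubleton_eq_iff)

lemma pfst_pair [simp]: "pfst (pair a b) = a"
  by (auto simp: pfst_def)

lemma psnd_pair [simp]: "psnd (pair a b) = b"
  by (auto simp: psnd_def)

lemma pair_in_times_set [simp]: "pair i j \<in> times_set I J \<longleftrightarrow> i \<in> I \<and> j \<in> J"
  by (auto simp: times_set_def)

lemma times_setE:
  assumes "p \<in> times_set I J"
  obtains i j where "p = pair i j" "i \<in> I" "j \<in> J"
  using assms by (auto simp: times_set_def)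

lemma small_times_set:
  assumes "small I" "small J"
  shows "small (times_set I J)"
proof -
  have "times_set I J = (\<Union>i\<in>I. pair i ` J)"
    by (auto simp: times_set_def)
  then show ?thesis
    using assms by (simp add: small_UN small_image)
qed

text \<open>\<open>enc\<close> is a definite description that can be decoded only on small sets.
  This is why smallness of the index set accompanies every later use of \<open>app\<close> on a
  graph.\<close>

lemma elts_graph: "small J \<Longrightarrow> elts (graph J \<alpha>) = (\<lambda>j. pair j (\<alpha> j)) ` J"
  unfolding graph_def by (subst elts_enc) (auto simp: Setcompr_eq_image small_image)

lemma app_graph [simp]: "small J \<Longrightarrow> j \<in> J \<Longrightarrow> app (graph J \<alpha>) j = \<alpha> j"
  by (auto simp: app_def elts_graph)

lemma graph_in_fun_set: "(\<And>j. j \<in> J \<Longrightarrow> \<alpha> j \<in> U) \<Longrightarrow> graph J \<alpha> \<in> fun_set J U"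
  by (auto simp: fun_set_def)

lemma app_in: "a \<in> fun_set J U \<Longrightarrow> small J \<Longrightarrow> j \<in> J \<Longrightarrow> app a j \<in> U"
  by (auto simp: fun_set_def Pi_iff)

lemma graph_cong: "(\<And>j. j \<in> J \<Longrightarrow> \<alpha> j = \<beta> j) \<Longrightarrow> graph J \<alpha> = graph J \<beta>"
  unfolding graph_def by (rule arg_cong[where f = enc]) auto

text \<open>A graph records its domain but not its codomain, so \<open>U\<close> and
  \<open>V\<close> may differ.\<close>

lemma fun_set_eqI:
  assumes "a \<in> fun_set J U" "b \<in> fun_set J V" "small J"
    and "\<And>j. j \<in> J \<Longrightarrow> app a j = app b j"
  shows "a = b"
  using assms by (auto simp: fun_set_def intro!: graph_cong)

text \<open>Graphs are codes of subsets of \<open>times_set J U\<close>, so they lie in its power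
  set.\<close>

lemma small_fun_set:
  assumes "small J" "small U"
  shows "small (fun_set J U)"
proof -
  let ?x = "enc (times_set J U)"
  have "fun_set J U \<subseteq> {y. elts y \<subseteq> elts ?x}"
    using assms by (auto simp: fun_set_def elts_graph elts_enc small_times_set Pi_iff)
  moreover have "small {y. elts y \<subseteq> elts ?x}"
    using elts_power[of ?x] by (auto simp: small_def)
  ultimately show ?thesis
    by (rule small_subset[rotated])
qed


section \<open>Categories, products and families\<close>

lemma (in category) hom_obj:
  assumes "f \<in> hom C X Y"
  shows "X \<in> Obj C" "Y \<in> Obj C"
  using assms dom_obj cod_obj by (auto simp: hom_def)

lemma is_isoI:
  assumes "f \<in> hom C X Y" "g \<in> hom C Y X"
    and "Comp C g f = Ident C X" "Comp C f g = Ident C Y"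
  shows "is_iso C f"
  using assms by (auto simp: is_iso_def hom_def)

lemma is_isoE:
  assumes "is_iso C f" "f \<in> hom C X Y"
  obtains g where "g \<in> hom C Y X" "Comp C g f = Ident C X" "Comp C f g = Ident C Y"
  using assms by (auto simp: is_iso_def hom_def)

lemma hom_prod_cat: "hom (prod_cat C D) X Y = hom C (fst X) (fst Y) \<times> hom D (snd X) (snd Y)"
  by (cases X; cases Y) (auto simp: hom_def prod_cat_def)

lemma prod_cat_simps [simp]:
  "Obj (prod_cat C D) = Obj C \<times> Obj D"
  "Ident (prod_cat C D) (X, Y) = (Ident C X, Ident D Y)"
  "Comp (prod_cat C D) (f', g') (f, g) = (Comp C f' f, Comp D g' g)"
  by (auto simp: prod_cat_def)

lemma category_prod_cat:
  assumes "category C" "category D"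
  shows "category (prod_cat C D)"
proof -
  interpret C: category C by fact
  interpret D: category D by fact
  show ?thesis
  proof
    fix f assume "f \<in> Arr (prod_cat C D)"
    then show "Dom (prod_cat C D) f \<in> Obj (prod_cat C D)" "Cod (prod_cat C D) f \<in> Obj (prod_cat C D)"
      by (auto simp: prod_cat_def C.dom_obj D.dom_obj C.cod_obj D.cod_obj)
  qed (auto simp: hom_prod_cat C.ident_hom D.ident_hom C.comp_assoc D.comp_assoc
      C.comp_ident_left D.comp_ident_left C.comp_ident_right D.comp_ident_right
      intro: C.comp_hom D.comp_hom)
qed

text \<open>The mediating arrow into a product. The description has the same shape as the one in
  \<open>prod_arr\<close>, so that \<open>prod_arr\<close> is an instance by mere unfolding and
  shares its lemmas.\<close>

definition tuple ::
  "('o, 'm) category \<Rightarrow> ('v, 'o, 'm) products \<Rightarrow> 'v set \<Rightarrow> ('v \<Rightarrow> 'o) \<Rightarrow> 'o \<Rightarrow> ('v \<Rightarrow> 'm) \<Rightarrow> 'm"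
  where "tuple C P J X A f =
    (THE h. h \<in> hom C A (pobj P J X) \<and> (\<forall>j \<in> J. Comp C (proj P J X j) h = f j))"

lemma prod_arr_eq_tuple:
  "prod_arr C P J X X' f = tuple C P J X' (pobj P J X) (\<lambda>j. Comp C (f j) (proj P J X j))"
  by (simp add: prod_arr_def tuple_def)

locale category_with_products = category C for C :: "('o, 'm) category" +
  fixes P :: "('v::set_universe, 'o, 'm) products"
  assumes has_products: "has_products C P"
begin

lemma is_product_pobj:
  assumes "small J" "X \<in> J \<rightarrow>\<^sub>E Obj C"
  shows "is_product C J X (pobj P J X) (proj P J X)"
  using has_products assms by (auto simp: has_products_def)

lemma pobj_obj: "small J \<Longrightarrow> X \<in> J \<rightarrow>\<^sub>E Obj C \<Longrightarrow> pobj P J X \<in> Obj C"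
  using is_product_pobj by (auto simp: is_product_def)

lemma proj_hom:
  "small J \<Longrightarrow> X \<in> J \<rightarrow>\<^sub>E Obj C \<Longrightarrow> j \<in> J \<Longrightarrow> proj P J X j \<in> hom C (pobj P J X) (X j)"
  using is_product_pobj by (auto simp: is_product_def)

lemma product_ex1:
  assumes "small J" "X \<in> J \<rightarrow>\<^sub>E Obj C" "A \<in> Obj C" "\<And>j. j \<in> J \<Longrightarrow> f j \<in> hom C A (X j)"
  shows "\<exists>!h. h \<in> hom C A (pobj P J X) \<and> (\<forall>j \<in> J. Comp C (proj P J X j) h = f j)"
  using is_product_pobj[OF assms(1,2)] assms(3,4) by (auto simp: is_product_def)

lemma
  assumes "small J" "X \<in> J \<rightarrow>\<^sub>E Obj C" "A \<in> Obj C" "\<And>j. j \<in> J \<Longrightarrow> f j \<in> hom C A (X j)"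
  shows tuple_hom: "tuple C P J X A f \<in> hom C A (pobj P J X)"
    and proj_tuple: "j \<in> J \<Longrightarrow> Comp C (proj P J X j) (tuple C P J X A f) = f j"
  using theI'[OF product_ex1[of J X A f, OF assms]] by (auto simp: tuple_def)

lemma product_eqI:
  assumes "small J" "X \<in> J \<rightarrow>\<^sub>E Obj C" "h \<in> hom C A (pobj P J X)" "k \<in> hom C A (pobj P J X)"
    and "\<And>j. j \<in> J \<Longrightarrow> Comp C (proj P J X j) h = Comp C (proj P J X j) k"
  shows "h = k"
  using product_ex1[of J X A "\<lambda>j. Comp C (proj P J X j) k"] assms hom_obj
  by (metis comp_hom proj_hom)

end

section \<open>The category of families: typing, equality and isomorphisms of arrows\<close>

lemma Fam_simps [simp]:
  "Obj (Fam C) = fam_obj C"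
  "Dom (Fam C) = src"
  "Cod (Fam C) = tgt"
  "src (Ident (Fam C) X) = X"
  "tgt (Ident (Fam C) X) = X"
  "imap (Ident (Fam C) X) = (\<lambda>i \<in> index X. i)"
  "comps (Ident (Fam C) X) = (\<lambda>i \<in> index X. Ident C (fib X i))"
  "src (Comp (Fam C) g f) = src f"
  "tgt (Comp (Fam C) g f) = tgt g"
  "imap (Comp (Fam C) g f) = (\<lambda>i \<in> index (src f). imap g (imap f i))"
  "comps (Comp (Fam C) g f) = (\<lambda>i \<in> index (src f). Comp C (comps g (imap f i)) (comps f i))"
  by (auto simp: Fam_def)

lemma fam_objD:
  assumes "X \<in> fam_obj C"
  shows fam_obj_small: "small (index X)"
    and fam_obj_fib: "i \<in> index X \<Longrightarrow> fib X i \<in> Obj C"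
  using assms by (auto simp: fam_obj_def)

lemma Fam_homI:
  assumes "X \<in> fam_obj C" "Y \<in> fam_obj C" "src f = X" "tgt f = Y"
    and "imap f \<in> extensional (index X)" "comps f \<in> extensional (index X)"
    and "\<And>i. i \<in> index X \<Longrightarrow> imap f i \<in> index Y"
    and "\<And>i. i \<in> index X \<Longrightarrow> comps f i \<in> hom C (fib X i) (fib Y (imap f i))"
  shows "f \<in> hom (Fam C) X Y"
  unfolding hom_def[of "Fam C"] using assms by (auto simp: Fam_def PiE_def)

lemma Fam_homD:
  assumes "f \<in> hom (Fam C) X Y"
  shows Fam_hom_dom: "X \<in> fam_obj C"
    and Fam_hom_cod: "Y \<in> fam_obj C"
    and Fam_hom_src: "src f = X"
    and Fam_hom_tgt: "tgt f = Y"
    and Fam_hom_imap_ext: "imap f \<in> extensional (index X)"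
    and Fam_hom_comps_ext: "comps f \<in> extensional (index X)"
    and Fam_hom_imap: "i \<in> index X \<Longrightarrow> imap f i \<in> index Y"
    and Fam_hom_comps: "i \<in> index X \<Longrightarrow> comps f i \<in> hom C (fib X i) (fib Y (imap f i))"
  using assms unfolding hom_def[of "Fam C"] by (auto simp: Fam_def PiE_def Pi_def)

text \<open>Both maps of an arrow are extensional, so nothing outside the index set has to be
  compared, and \<open>src\<close> and \<open>tgt\<close> are fixed by the hom-set. Once the two
  typing facts are supplied by \<open>OF\<close>, each law in the category of families splits into
  an equation of indices and an equation in the base category.\<close>

lemma Fam_arr_eqI:
  assumes "f \<in> hom (Fam C) X Y" "g \<in> hom (Fam C) X Y"
    and "\<And>i. i \<in> index X \<Longrightarrow> imap f i = imap g i"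
    and "\<And>i. i \<in> index X \<Longrightarrow> comps f i = comps g i"
  shows "f = g"
proof -
  have "imap f = imap g" "comps f = comps g"
    using assms by (auto intro: extensionalityI Fam_hom_imap_ext Fam_hom_comps_ext)
  then show ?thesis
    using Fam_homD(3,4)[OF assms(1)] Fam_homD(3,4)[OF assms(2)] by (cases f; cases g) auto
qed

context category
begin

lemma Fam_Ident_hom: "X \<in> fam_obj C \<Longrightarrow> Ident (Fam C) X \<in> hom (Fam C) X X"
  by (rule Fam_homI) (auto simp: fam_objD ident_hom)

lemma Fam_Comp_hom:
  assumes f: "f \<in> hom (Fam C) X Y" and g: "g \<in> hom (Fam C) Y Z"
  shows "Comp (Fam C) g f \<in> hom (Fam C) X Z"
  by (rule Fam_homI)
    (auto simp: Fam_homD[OF f] Fam_homD[OF g]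
      intro!: comp_hom[OF Fam_hom_comps[OF f] Fam_hom_comps[OF g]])

lemma category_Fam: "category (Fam C :: (('v::set_universe, 'o) fam, ('v, 'o, 'm) fam_arr) category)"
proof
  show "Dom (Fam C) f \<in> Obj (Fam C)" "Cod (Fam C) f \<in> Obj (Fam C)" if "f \<in> Arr (Fam C)"
    for f :: "('v, 'o, 'm) fam_arr"
    using that by (auto simp: Fam_def)
  show "Ident (Fam C) X \<in> hom (Fam C) X X" if "X \<in> Obj (Fam C)" for X :: "('v, 'o) fam"
    using that by (simp add: Fam_Ident_hom)
  fix W X Y Z :: "('v, 'o) fam" and f g h
  assume f: "f \<in> hom (Fam C) W X"
  \<comment> \<open>Fact 8 of \<open>Fam_homD\<close> types the components. It is used to
    instantiate the laws of the base category, whose premises mention objects absent from their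
    equations.\<close>
  note f' = Fam_homD[OF f]
  show "Comp (Fam C) f (Ident (Fam C) W) = f"
    by (rule Fam_arr_eqI[OF Fam_Comp_hom[OF Fam_Ident_hom f] f])
      (auto simp: f' comp_ident_right[OF f'(8)])
  show "Comp (Fam C) (Ident (Fam C) X) f = f"
    by (rule Fam_arr_eqI[OF Fam_Comp_hom[OF f Fam_Ident_hom] f])
      (auto simp: f' comp_ident_left[OF f'(8)])
  assume g: "g \<in> hom (Fam C) X Y"
  note g' = Fam_homD[OF g]
  show "Comp (Fam C) g f \<in> hom (Fam C) W Y"
    using f g by (rule Fam_Comp_hom)
  assume h: "h \<in> hom (Fam C) Y Z"
  note h' = Fam_homD[OF h]
  show "Comp (Fam C) h (Comp (Fam C) g f) = Comp (Fam C) (Comp (Fam C) h g) f"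
    by (rule Fam_arr_eqI[OF Fam_Comp_hom[OF Fam_Comp_hom[OF f g] h]
          Fam_Comp_hom[OF f Fam_Comp_hom[OF g h]]])
      (auto simp: f' g' h' comp_assoc[OF f'(8) g'(8) h'(8)])
qed

text \<open>Invert the index map and each component separately. This reduces every structure
  isomorphism of families to a bijection of index sets and the corresponding isomorphism in the base
  category.\<close>

lemma Fam_isoI:
  assumes f: "f \<in> hom (Fam C) X Y" and bij: "bij_betw (imap f) (index X) (index Y)"
    and iso: "\<And>i. i \<in> index X \<Longrightarrow> is_iso C (comps f i)"
  shows "is_iso (Fam C) f"
proof -
  note f' = Fam_homD[OF f]
  have "\<exists>g. g \<in> hom C (fib Y (imap f i)) (fib X i) \<and>
      Comp C g (comps f i) = Ident C (fib X i) \<and>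
      Comp C (comps f i) g = Ident C (fib Y (imap f i))" if "i \<in> index X" for i
    using iso[OF that] f'(8)[OF that] by (auto elim: is_isoE)
  then obtain g where g: "\<And>i. i \<in> index X \<Longrightarrow> g i \<in> hom C (fib Y (imap f i)) (fib X i)"
    "\<And>i. i \<in> index X \<Longrightarrow> Comp C (g i) (comps f i) = Ident C (fib X i)"
    "\<And>i. i \<in> index X \<Longrightarrow> Comp C (comps f i) (g i) = Ident C (fib Y (imap f i))"
    by metis
  define r where "r = inv_into (index X) (imap f)"
  have r1: "r (imap f i) = i" if "i \<in> index X" for i
    using bij that unfolding r_def by (simp add: bij_betw_def)
  have r2: "r j \<in> index X" "imap f (r j) = j" if "j \<in> index Y" for j
    using bij that unfolding r_def by (auto simp: bij_betw_def inv_into_into f_inv_into_f)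
  \<comment> \<open>The inverse of the component over \<open>r j\<close> starts at
    \<open>fib Y (imap f (r j))\<close>. This is \<open>fib Y j\<close> because
    \<open>imap f (r j) = j\<close>, so \<open>k\<close> is well typed only thanks to
    \<open>r2\<close>.\<close>
  define k where "k = \<lparr> src = Y, tgt = X, imap = restrict r (index Y),
      comps = (\<lambda>j \<in> index Y. g (r j)) \<rparr>"
  have k: "k \<in> hom (Fam C) Y X"
    by (rule Fam_homI) (use g(1)[OF r2(1)] in \<open>auto simp: k_def f' r2\<close>)
  show ?thesis
  proof (rule is_isoI[OF f k])
    show "Comp (Fam C) k f = Ident (Fam C) X"
      by (rule Fam_arr_eqI[OF Fam_Comp_hom[OF f k] Fam_Ident_hom])
        (auto simp: k_def f' r1 g)
    show "Comp (Fam C) f k = Ident (Fam C) Y"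
      by (rule Fam_arr_eqI[OF Fam_Comp_hom[OF k f] Fam_Ident_hom])
        (use g(3)[OF r2(1)] in \<open>auto simp: k_def f' r2\<close>)
  qed
qed

end


section \<open>The tensor product of families\<close>

lemma Fam_monoidal_simps [simp]:
  "cat (Fam_monoidal M) = Fam (cat M)"
  "tens_obj (Fam_monoidal M) X Y = fam_tens_obj M X Y"
  "tens_arr (Fam_monoidal M) f g = fam_tens_arr M f g"
  "unit_obj (Fam_monoidal M) = fam_unit M"
  "assoc (Fam_monoidal M) = fam_assoc M"
  "lunit (Fam_monoidal M) = fam_lunit M"
  "runit (Fam_monoidal M) = fam_runit M"
  by (auto simp: Fam_monoidal_def)

lemma fam_tens_simps [simp]:
  "index (fam_tens_obj M X Y) = times_set (index X) (index Y)"
  "fib (fam_tens_obj M X Y) = (\<lambda>p \<in> times_set (index X) (index Y).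
    tens_obj M (fib X (pfst p)) (fib Y (psnd p)))"
  "src (fam_tens_arr M f g) = fam_tens_obj M (src f) (src g)"
  "tgt (fam_tens_arr M f g) = fam_tens_obj M (tgt f) (tgt g)"
  "imap (fam_tens_arr M f g) = (\<lambda>p \<in> times_set (index (src f)) (index (src g)).
    pair (imap f (pfst p)) (imap g (psnd p)))"
  "comps (fam_tens_arr M f g) = (\<lambda>p \<in> times_set (index (src f)) (index (src g)).
    tens_arr M (comps f (pfst p)) (comps g (psnd p)))"
  by (auto simp: fam_tens_obj_def fam_tens_arr_def)

lemma fam_unit_simps [simp]:
  "index (fam_unit M) = {enc {}}"
  "fib (fam_unit M) = (\<lambda>i \<in> {enc {}}. unit_obj M)"
  by (auto simp: fam_unit_def)

context monoidal_category
begin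

lemma tens_obj: "X \<in> Obj (cat M) \<Longrightarrow> Y \<in> Obj (cat M) \<Longrightarrow> tens_obj M X Y \<in> Obj (cat M)"
  by (simp add: tensor.onobj)

lemma tens_hom:
  "f \<in> hom (cat M) X X' \<Longrightarrow> g \<in> hom (cat M) Y Y' \<Longrightarrow>
    tens_arr M f g \<in> hom (cat M) (tens_obj M X Y) (tens_obj M X' Y')"
  by (rule tensor.onarr) (simp add: hom_prod_cat)

lemma tens_ident:
  "X \<in> Obj (cat M) \<Longrightarrow> Y \<in> Obj (cat M) \<Longrightarrow>
    tens_arr M (Ident (cat M) X) (Ident (cat M) Y) = Ident (cat M) (tens_obj M X Y)"
  using tensor.onarr_ident[of "(X, Y)"] by simp

lemma tens_comp:
  assumes "f \<in> hom (cat M) X X'" "f' \<in> hom (cat M) X' X''"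
    and "g \<in> hom (cat M) Y Y'" "g' \<in> hom (cat M) Y' Y''"
  shows "tens_arr M (Comp (cat M) f' f) (Comp (cat M) g' g) =
    Comp (cat M) (tens_arr M f' g') (tens_arr M f g)"
  using tensor.onarr_comp[of "(f, g)" "(X, Y)" "(X', Y')" "(f', g')" "(X'', Y'')"] assms
  by (simp add: hom_prod_cat)

section \<open>The tensor product and the structure maps of families\<close>

lemma fam_tens_obj:
  "X \<in> fam_obj (cat M) \<Longrightarrow> Y \<in> fam_obj (cat M) \<Longrightarrow> fam_tens_obj M X Y \<in> fam_obj (cat M)"
  by (auto simp: fam_obj_def small_times_set elim!: times_setE intro!: tens_obj)

lemma fam_unit_obj: "fam_unit M \<in> fam_obj (cat M)"
  by (auto simp: fam_obj_def unit_obj)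

lemma fam_tens_arr_hom:
  assumes f: "f \<in> hom (Fam (cat M)) X X'" and g: "g \<in> hom (Fam (cat M)) Y Y'"
  shows "fam_tens_arr M f g \<in> hom (Fam (cat M)) (fam_tens_obj M X Y) (fam_tens_obj M X' Y')"
  by (rule Fam_homI)
    (auto simp: fam_tens_obj Fam_homD[OF f] Fam_homD[OF g] elim!: times_setE
      intro!: tens_hom[OF Fam_hom_comps[OF f] Fam_hom_comps[OF g]])

lemma fam_assoc_hom:
  assumes "X \<in> fam_obj (cat M)" "Y \<in> fam_obj (cat M)" "Z \<in> fam_obj (cat M)"
  shows "fam_assoc M X Y Z \<in> hom (Fam (cat M))
    (fam_tens_obj M (fam_tens_obj M X Y) Z) (fam_tens_obj M X (fam_tens_obj M Y Z))"
  by (rule Fam_homI)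
    (auto simp: fam_assoc_def fam_tens_obj assms assoc_hom fam_obj_fib[OF assms(1)]
      fam_obj_fib[OF assms(2)] fam_obj_fib[OF assms(3)] elim!: times_setE)

lemma fam_lunit_hom:
  assumes "X \<in> fam_obj (cat M)"
  shows "fam_lunit M X \<in> hom (Fam (cat M)) (fam_tens_obj M (fam_unit M) X) X"
  by (rule Fam_homI)
    (auto simp: fam_lunit_def fam_tens_obj fam_unit_obj assms lunit_hom fam_obj_fib[OF assms]
      elim!: times_setE)

lemma fam_runit_hom:
  assumes "X \<in> fam_obj (cat M)"
  shows "fam_runit M X \<in> hom (Fam (cat M)) (fam_tens_obj M X (fam_unit M)) X"
  by (rule Fam_homI)
    (auto simp: fam_runit_def fam_tens_obj fam_unit_obj assms runit_hom fam_obj_fib[OF assms]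
      elim!: times_setE)

text \<open>The index map only rebrackets triples, and the opposite rebracketing is its inverse; the
  components are associators of the base category.\<close>

lemma fam_assoc_iso:
  assumes "X \<in> fam_obj (cat M)" "Y \<in> fam_obj (cat M)" "Z \<in> fam_obj (cat M)"
  shows "is_iso (Fam (cat M)) (fam_assoc M X Y Z)"
proof (rule Fam_isoI[OF fam_assoc_hom[OF assms]])
  show "bij_betw (imap (fam_assoc M X Y Z)) (index (fam_tens_obj M (fam_tens_obj M X Y) Z)) (index (fam_tens_obj M X (fam_tens_obj M Y Z)))"
    by (rule bij_betw_byWitness[where f' = "\<lambda>p. pair (pair (pfst p) (pfst (psnd p))) (psnd (psnd p))"])
      (auto simp: fam_assoc_def elim!: times_setE)
qed (auto simp: fam_assoc_def assoc_iso assms[THEN fam_obj_fib] elim!: times_setE)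

text \<open>The unit family has the single index \<open>enc {}\<close>, so pairing with it undoes
  the projection.\<close>

lemma fam_lunit_iso:
  assumes "X \<in> fam_obj (cat M)"
  shows "is_iso (Fam (cat M)) (fam_lunit M X)"
proof (rule Fam_isoI[OF fam_lunit_hom[OF assms]])
  show "bij_betw (imap (fam_lunit M X)) (index (fam_tens_obj M (fam_unit M) X)) (index X)"
    by (rule bij_betw_byWitness[where f' = "\<lambda>p. pair (enc {}) p"])
      (auto simp: fam_lunit_def elim!: times_setE)
qed (auto simp: fam_lunit_def lunit_iso assms[THEN fam_obj_fib] elim!: times_setE)

lemma fam_runit_iso:
  assumes "X \<in> fam_obj (cat M)"
  shows "is_iso (Fam (cat M)) (fam_runit M X)"
proof (rule Fam_isoI[OF fam_runit_hom[OF assms]])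
  show "bij_betw (imap (fam_runit M X)) (index (fam_tens_obj M X (fam_unit M))) (index X)"
    by (rule bij_betw_byWitness[where f' = "\<lambda>p. pair p (enc {})"])
      (auto simp: fam_runit_def elim!: times_setE)
qed (auto simp: fam_runit_def runit_iso assms[THEN fam_obj_fib] elim!: times_setE)

section \<open>Functoriality of the tensor product and coherence laws, index by index\<close>

lemma fam_tens_ident:
  assumes X: "X \<in> fam_obj (cat M)" and Y: "Y \<in> fam_obj (cat M)"
  shows "fam_tens_arr M (Ident (Fam (cat M)) X) (Ident (Fam (cat M)) Y) =
    Ident (Fam (cat M)) (fam_tens_obj M X Y)"
  by (rule Fam_arr_eqI[OF fam_tens_arr_hom[OF Fam_Ident_hom[OF X] Fam_Ident_hom[OF Y]]
        Fam_Ident_hom[OF fam_tens_obj[OF X Y]]])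
    (auto simp: tens_ident fam_obj_fib[OF X] fam_obj_fib[OF Y] elim!: times_setE)

lemma fam_tens_comp:
  assumes f: "f \<in> hom (Fam (cat M)) X X'" and f': "f' \<in> hom (Fam (cat M)) X' X''"
    and g: "g \<in> hom (Fam (cat M)) Y Y'" and g': "g' \<in> hom (Fam (cat M)) Y' Y''"
  shows "fam_tens_arr M (Comp (Fam (cat M)) f' f) (Comp (Fam (cat M)) g' g) =
    Comp (Fam (cat M)) (fam_tens_arr M f' g') (fam_tens_arr M f g)"
  by (rule Fam_arr_eqI[OF fam_tens_arr_hom[OF Fam_Comp_hom[OF f f'] Fam_Comp_hom[OF g g']]
        Fam_Comp_hom[OF fam_tens_arr_hom[OF f g] fam_tens_arr_hom[OF f' g']]])
    (auto simp: Fam_homD[OF f] Fam_homD[OF g] Fam_homD[OF f'] Fam_homD[OF g'] elim!: times_setE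
      intro!: tens_comp[OF Fam_hom_comps[OF f] Fam_hom_comps[OF f']
        Fam_hom_comps[OF g] Fam_hom_comps[OF g']])

lemma fam_assoc_natural:
  assumes f: "f \<in> hom (Fam (cat M)) X X'" and g: "g \<in> hom (Fam (cat M)) Y Y'"
    and h: "h \<in> hom (Fam (cat M)) Z Z'"
  shows "Comp (Fam (cat M)) (fam_assoc M X' Y' Z') (fam_tens_arr M (fam_tens_arr M f g) h) =
    Comp (Fam (cat M)) (fam_tens_arr M f (fam_tens_arr M g h)) (fam_assoc M X Y Z)"
  by (rule Fam_arr_eqI[OF Fam_Comp_hom[OF fam_tens_arr_hom[OF fam_tens_arr_hom[OF f g] h]
          fam_assoc_hom] Fam_Comp_hom[OF fam_assoc_hom fam_tens_arr_hom[OF f fam_tens_arr_hom[OF g h]]]])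
    (auto simp: fam_assoc_def Fam_homD[OF f] Fam_homD[OF g] Fam_homD[OF h] elim!: times_setE
      intro!: assoc_natural[OF Fam_hom_comps[OF f] Fam_hom_comps[OF g] Fam_hom_comps[OF h]])

lemma fam_lunit_natural:
  assumes f: "f \<in> hom (Fam (cat M)) X Y"
  shows "Comp (Fam (cat M)) (fam_lunit M Y)
      (fam_tens_arr M (Ident (Fam (cat M)) (fam_unit M)) f) =
    Comp (Fam (cat M)) f (fam_lunit M X)"
  by (rule Fam_arr_eqI[OF Fam_Comp_hom[OF fam_tens_arr_hom[OF Fam_Ident_hom[OF fam_unit_obj] f]
          fam_lunit_hom] Fam_Comp_hom[OF fam_lunit_hom f]])
    (auto simp: fam_lunit_def Fam_homD[OF f] elim!: times_setE
      intro!: lunit_natural[OF Fam_hom_comps[OF f]])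

lemma fam_runit_natural:
  assumes f: "f \<in> hom (Fam (cat M)) X Y"
  shows "Comp (Fam (cat M)) (fam_runit M Y)
      (fam_tens_arr M f (Ident (Fam (cat M)) (fam_unit M))) =
    Comp (Fam (cat M)) f (fam_runit M X)"
  by (rule Fam_arr_eqI[OF Fam_Comp_hom[OF fam_tens_arr_hom[OF f Fam_Ident_hom[OF fam_unit_obj]]
          fam_runit_hom] Fam_Comp_hom[OF fam_runit_hom f]])
    (auto simp: fam_runit_def Fam_homD[OF f] elim!: times_setE
      intro!: runit_natural[OF Fam_hom_comps[OF f]])

lemma fam_triangle:
  assumes X: "X \<in> fam_obj (cat M)" and Y: "Y \<in> fam_obj (cat M)"
  shows "Comp (Fam (cat M)) (fam_tens_arr M (Ident (Fam (cat M)) X) (fam_lunit M Y))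
      (fam_assoc M X (fam_unit M) Y) =
    fam_tens_arr M (fam_runit M X) (Ident (Fam (cat M)) Y)"
  by (rule Fam_arr_eqI[OF Fam_Comp_hom[OF fam_assoc_hom[OF X fam_unit_obj Y]
          fam_tens_arr_hom[OF Fam_Ident_hom[OF X] fam_lunit_hom[OF Y]]]
        fam_tens_arr_hom[OF fam_runit_hom[OF X] Fam_Ident_hom[OF Y]]])
    (auto simp: fam_assoc_def fam_lunit_def fam_runit_def triangle fam_obj_fib[OF X]
      fam_obj_fib[OF Y] elim!: times_setE)

lemma fam_pentagon:
  assumes W: "W \<in> fam_obj (cat M)" and X: "X \<in> fam_obj (cat M)"
    and Y: "Y \<in> fam_obj (cat M)" and Z: "Z \<in> fam_obj (cat M)"
  shows "Comp (Fam (cat M)) (fam_tens_arr M (Ident (Fam (cat M)) W) (fam_assoc M X Y Z))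
      (Comp (Fam (cat M)) (fam_assoc M W (fam_tens_obj M X Y) Z)
        (fam_tens_arr M (fam_assoc M W X Y) (Ident (Fam (cat M)) Z))) =
    Comp (Fam (cat M)) (fam_assoc M W X (fam_tens_obj M Y Z)) (fam_assoc M (fam_tens_obj M W X) Y Z)"
    (is "?l = ?r")
proof (rule Fam_arr_eqI[OF
      Fam_Comp_hom[OF Fam_Comp_hom[OF
          fam_tens_arr_hom[OF fam_assoc_hom[OF W X Y] Fam_Ident_hom[OF Z]]
          fam_assoc_hom[OF W fam_tens_obj[OF X Y] Z]]
        fam_tens_arr_hom[OF Fam_Ident_hom[OF W] fam_assoc_hom[OF X Y Z]]]
      Fam_Comp_hom[OF fam_assoc_hom[OF fam_tens_obj[OF W X] Y Z]
        fam_assoc_hom[OF W X fam_tens_obj[OF Y Z]]]])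
  fix p assume "p \<in> index (fam_tens_obj M (fam_tens_obj M (fam_tens_obj M W X) Y) Z)"
  \<comment> \<open>On an explicit nested quadruple all \<open>pfst\<close> and \<open>psnd\<close>
    compute. Both index maps then yield the same rebracketing, and the components are the two sides
    of the pentagon at the four fibres.\<close>
  then obtain w x y z where p: "p = pair (pair (pair w x) y) z" "w \<in> index W" "x \<in> index X"
    "y \<in> index Y" "z \<in> index Z"
    by (auto elim!: times_setE)
  show "imap ?l p = imap ?r p"
    using p by (simp add: fam_assoc_def)
  show "comps ?l p = comps ?r p"
    using p by (simp add: fam_assoc_def pentagon fam_objD[OF W] fam_objD[OF X] fam_objD[OF Y]
        fam_objD[OF Z])
qed

lemma monoidal_category_Fam:
  "monoidal_category (Fam_monoidal M :: (('v::set_universe, 'o) fam, ('v, 'o, 'm) fam_arr) monoidal)"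
proof (intro monoidal_category.intro cat_functor.intro)
  let ?F = "Fam_monoidal M :: (('v, 'o) fam, ('v, 'o, 'm) fam_arr) monoidal"
  show "category (cat ?F)" "category (cat ?F)" "category (prod_cat (cat ?F) (cat ?F))"
    by (simp_all add: category_Fam category_prod_cat)
  show "cat_functor_axioms (prod_cat (cat ?F) (cat ?F)) (cat ?F) (tensor ?F)"
    by unfold_locales
      (auto simp: hom_prod_cat fam_tens_obj fam_tens_ident fam_tens_arr_hom fam_tens_comp)
  show "monoidal_category_axioms ?F"
    unfolding monoidal_category_axioms_def Fam_monoidal_simps Fam_simps
    by (intro conjI allI impI fam_unit_obj fam_assoc_hom fam_assoc_iso fam_assoc_natural
        fam_lunit_hom fam_lunit_iso fam_lunit_natural fam_runit_hom fam_runit_iso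
        fam_runit_natural fam_triangle fam_pentagon)
qed

end


section \<open>The internal hom of families\<close>

locale closed_monoidal_with_products =
  closed_monoidal_category M H + category_with_products "cat M" P
  for M :: "('o, 'm) monoidal"
    and H :: "'o \<Rightarrow> ('o, 'm, 'o, 'm) cat_functor"
    and P :: "('v::set_universe, 'o, 'm) products"
begin

text \<open>\<open>is_right_adjoint\<close> only asserts that some natural bijection exists, so one
  is chosen for each \<open>Y\<close>. The choices for different objects \<open>Y\<close> are
  unrelated; each fibre of a family uses its own.\<close>

definition curry :: "'o \<Rightarrow> 'o \<Rightarrow> 'o \<Rightarrow> 'm \<Rightarrow> 'm" where
  "curry Y = (SOME \<phi>. adjunction (cat M) (cat M) (tensor_right M Y) (H Y) \<phi>)"

definition uncurry :: "'o \<Rightarrow> 'o \<Rightarrow> 'o \<Rightarrow> 'm \<Rightarrow> 'm" where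
  "uncurry Y A B = inv_into (hom (cat M) (tens_obj M A Y) B) (curry Y A B)"

lemma adjunction_curry:
  "Y \<in> Obj (cat M) \<Longrightarrow> adjunction (cat M) (cat M) (tensor_right M Y) (H Y) (curry Y)"
  unfolding curry_def using internal_hom by (metis is_right_adjoint_def someI_ex)

lemma cat_functor_H: "Y \<in> Obj (cat M) \<Longrightarrow> cat_functor (cat M) (cat M) (H Y)"
  using adjunction_curry by (rule adjunction.axioms(2))

lemma H_obj: "Y \<in> Obj (cat M) \<Longrightarrow> Z \<in> Obj (cat M) \<Longrightarrow> onobj (H Y) Z \<in> Obj (cat M)"
  by (rule cat_functor.onobj[OF cat_functor_H])

lemma H_hom:
  "Y \<in> Obj (cat M) \<Longrightarrow> f \<in> hom (cat M) Z Z' \<Longrightarrow>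
    onarr (H Y) f \<in> hom (cat M) (onobj (H Y) Z) (onobj (H Y) Z')"
  by (rule cat_functor.onarr[OF cat_functor_H])

lemma H_ident:
  "Y \<in> Obj (cat M) \<Longrightarrow> Z \<in> Obj (cat M) \<Longrightarrow>
    onarr (H Y) (Ident (cat M) Z) = Ident (cat M) (onobj (H Y) Z)"
  by (rule cat_functor.onarr_ident[OF cat_functor_H])

lemma H_comp:
  "Y \<in> Obj (cat M) \<Longrightarrow> f \<in> hom (cat M) Z Z' \<Longrightarrow> g \<in> hom (cat M) Z' Z'' \<Longrightarrow>
    onarr (H Y) (Comp (cat M) g f) = Comp (cat M) (onarr (H Y) g) (onarr (H Y) f)"
  by (rule cat_functor.onarr_comp[OF cat_functor_H])

lemma curry_bij:
  "Y \<in> Obj (cat M) \<Longrightarrow> A \<in> Obj (cat M) \<Longrightarrow> B \<in> Obj (cat M) \<Longrightarrow>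
    bij_betw (curry Y A B) (hom (cat M) (tens_obj M A Y) B) (hom (cat M) A (onobj (H Y) B))"
  using adjunction.bij[OF adjunction_curry] by (simp add: tensor_right_def)

lemma curry_natural:
  "Y \<in> Obj (cat M) \<Longrightarrow> f \<in> hom (cat M) A' A \<Longrightarrow> g \<in> hom (cat M) B B' \<Longrightarrow>
    h \<in> hom (cat M) (tens_obj M A Y) B \<Longrightarrow>
    curry Y A' B' (Comp (cat M) g (Comp (cat M) h (tens_arr M f (Ident (cat M) Y)))) =
    Comp (cat M) (onarr (H Y) g) (Comp (cat M) (curry Y A B h) f)"
  using adjunction.natural[OF adjunction_curry] by (simp add: tensor_right_def)

lemma
  assumes "Y \<in> Obj (cat M)" "A \<in> Obj (cat M)" "B \<in> Obj (cat M)"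
  shows curry_hom: "h \<in> hom (cat M) (tens_obj M A Y) B \<Longrightarrow>
      curry Y A B h \<in> hom (cat M) A (onobj (H Y) B)"
    and uncurry_hom: "k \<in> hom (cat M) A (onobj (H Y) B) \<Longrightarrow>
      uncurry Y A B k \<in> hom (cat M) (tens_obj M A Y) B"
    and uncurry_curry: "h \<in> hom (cat M) (tens_obj M A Y) B \<Longrightarrow> uncurry Y A B (curry Y A B h) = h"
    and curry_uncurry: "k \<in> hom (cat M) A (onobj (H Y) B) \<Longrightarrow> curry Y A B (uncurry Y A B k) = k"
  using curry_bij[OF assms] unfolding bij_betw_def uncurry_def
  by (auto simp: inv_into_into f_inv_into_f)

section \<open>The internal hom of two families, and arrows into it\<close>

lemma ihom_factors_PiE:
  assumes Y: "Y \<in> fam_obj (cat M)" and Z: "Z \<in> fam_obj (cat M)"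
    and \<alpha>: "\<alpha> \<in> fun_set (index Y) (index Z)"
  shows "ihom_factors H Y Z \<alpha> \<in> index Y \<rightarrow>\<^sub>E Obj (cat M)"
  by (auto simp: ihom_factors_def fam_objD[OF Y] fam_objD[OF Z] app_in[OF \<alpha>] intro!: H_obj)

lemma fam_ihom_obj_simps [simp]:
  "index (fam_ihom_obj H P Y Z) = fun_set (index Y) (index Z)"
  "fib (fam_ihom_obj H P Y Z) = (\<lambda>\<alpha> \<in> fun_set (index Y) (index Z).
    pobj P (index Y) (ihom_factors H Y Z \<alpha>))"
  by (auto simp: fam_ihom_obj_def)

lemma fam_ihom_obj:
  assumes Y: "Y \<in> fam_obj (cat M)" and Z: "Z \<in> fam_obj (cat M)"
  shows "fam_ihom_obj H P Y Z \<in> fam_obj (cat M)"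
  using small_fun_set[OF fam_obj_small[OF Y] fam_obj_small[OF Z]]
    pobj_obj[OF fam_obj_small[OF Y] ihom_factors_PiE[OF Y Z]]
  by (auto simp: fam_obj_def)

text \<open>
  \<open>coord Y Z k i j\<close> is the component \<open>A\<^sub>i \<rightarrow> [Y\<^sub>j, Z\<^bsub>k(i)(j)\<^esub>]\<close> of an arrow \<open>k : A \<rightarrow> [Y, Z]\<close>.
\<close>

definition coord :: "('v, 'o) fam \<Rightarrow> ('v, 'o) fam \<Rightarrow> ('v, 'o, 'm) fam_arr \<Rightarrow> 'v \<Rightarrow> 'v \<Rightarrow> 'm" where
  "coord Y Z k i j =
    Comp (cat M) (proj P (index Y) (ihom_factors H Y Z (imap k i)) j) (comps k i)"

text \<open>The arrow into \<open>[Y, Z]\<close> with prescribed coordinates: \<open>m i j\<close>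
  for the indices and \<open>e i j\<close> for \<open>coord\<close>. Both the transposes and the
  arrows \<open>[Y, c]\<close> are instances, so typing and coordinates are computed once for all of
  them.\<close>

definition fam_lam ::
  "('v, 'o) fam \<Rightarrow> ('v, 'o) fam \<Rightarrow> ('v, 'o) fam \<Rightarrow> ('v \<Rightarrow> 'v \<Rightarrow> 'v) \<Rightarrow> ('v \<Rightarrow> 'v \<Rightarrow> 'm) \<Rightarrow>
   ('v, 'o, 'm) fam_arr" where
  "fam_lam A Y Z m e =
    \<lparr> src = A,
      tgt = fam_ihom_obj H P Y Z,
      imap = (\<lambda>i \<in> index A. graph (index Y) (m i)),
      comps = (\<lambda>i \<in> index A.
        tuple (cat M) P (index Y) (ihom_factors H Y Z (graph (index Y) (m i))) (fib A i) (e i)) \<rparr>"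

lemma proj_ihom_hom:
  assumes Y: "Y \<in> fam_obj (cat M)" and Z: "Z \<in> fam_obj (cat M)"
    and \<alpha>: "\<alpha> \<in> fun_set (index Y) (index Z)" and j: "j \<in> index Y"
  shows "proj P (index Y) (ihom_factors H Y Z \<alpha>) j \<in>
    hom (cat M) (fib (fam_ihom_obj H P Y Z) \<alpha>) (onobj (H (fib Y j)) (fib Z (app \<alpha> j)))"
  using proj_hom[OF fam_obj_small[OF Y] ihom_factors_PiE[OF Y Z \<alpha>] j] \<alpha> j
  by (simp add: ihom_factors_def)

lemma coord_hom:
  assumes Y: "Y \<in> fam_obj (cat M)" and Z: "Z \<in> fam_obj (cat M)"
    and k: "k \<in> hom (Fam (cat M)) A (fam_ihom_obj H P Y Z)"
    and i: "i \<in> index A" and j: "j \<in> index Y"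
  shows "coord Y Z k i j \<in> hom (cat M) (fib A i) (onobj (H (fib Y j)) (fib Z (app (imap k i) j)))"
  unfolding coord_def
  using comp_hom[OF Fam_hom_comps[OF k i] proj_ihom_hom[OF Y Z _ j]] Fam_hom_imap[OF k i] by simp

text \<open>The index maps must be compared first: only after \<open>imap k i = imap l i\<close> do
  the two components land in the same product, where the projections separate them.\<close>

lemma fam_ihom_eqI:
  assumes Y: "Y \<in> fam_obj (cat M)" and Z: "Z \<in> fam_obj (cat M)"
    and k: "k \<in> hom (Fam (cat M)) A (fam_ihom_obj H P Y Z)"
    and l: "l \<in> hom (Fam (cat M)) A (fam_ihom_obj H P Y Z)"
    and app: "\<And>i j. i \<in> index A \<Longrightarrow> j \<in> index Y \<Longrightarrow> app (imap k i) j = app (imap l i) j"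
    and coord: "\<And>i j. i \<in> index A \<Longrightarrow> j \<in> index Y \<Longrightarrow> coord Y Z k i j = coord Y Z l i j"
  shows "k = l"
proof (rule Fam_arr_eqI[OF k l])
  fix i assume i: "i \<in> index A"
  have ki: "imap k i \<in> fun_set (index Y) (index Z)" and li: "imap l i \<in> fun_set (index Y) (index Z)"
    using Fam_hom_imap[OF k i] Fam_hom_imap[OF l i] by simp_all
  show eq: "imap k i = imap l i"
    using fun_set_eqI[OF ki li fam_obj_small[OF Y] app[OF i]] .
  show "comps k i = comps l i"
  proof (rule product_eqI[OF fam_obj_small[OF Y] ihom_factors_PiE[OF Y Z ki]])
    show "comps k i \<in> hom (cat M) (fib A i) (pobj P (index Y) (ihom_factors H Y Z (imap k i)))"
      using Fam_hom_comps[OF k i] ki by simp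
    show "comps l i \<in> hom (cat M) (fib A i) (pobj P (index Y) (ihom_factors H Y Z (imap k i)))"
      using Fam_hom_comps[OF l i] li eq by simp
  qed (use coord[OF i] eq in \<open>simp add: coord_def\<close>)
qed

context
  fixes A Y Z :: "('v, 'o) fam" and m :: "'v \<Rightarrow> 'v \<Rightarrow> 'v" and e :: "'v \<Rightarrow> 'v \<Rightarrow> 'm"
  assumes A: "A \<in> fam_obj (cat M)" and Y: "Y \<in> fam_obj (cat M)" and Z: "Z \<in> fam_obj (cat M)"
    and m: "\<And>i j. i \<in> index A \<Longrightarrow> j \<in> index Y \<Longrightarrow> m i j \<in> index Z"
    and e: "\<And>i j. i \<in> index A \<Longrightarrow> j \<in> index Y \<Longrightarrow>
      e i j \<in> hom (cat M) (fib A i) (onobj (H (fib Y j)) (fib Z (m i j)))"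
begin

lemma fam_lam_graph: "i \<in> index A \<Longrightarrow> graph (index Y) (m i) \<in> fun_set (index Y) (index Z)"
  using m by (auto intro: graph_in_fun_set)

text \<open>The factors of the product are read off the encoded function, whereas \<open>e\<close>
  is typed with \<open>m\<close>. Evaluating the graph with \<open>app_graph\<close> identifies the
  two codomains.\<close>

lemma fam_lam_factor:
  "i \<in> index A \<Longrightarrow> j \<in> index Y \<Longrightarrow>
    e i j \<in> hom (cat M) (fib A i) (ihom_factors H Y Z (graph (index Y) (m i)) j)"
  using e by (simp add: ihom_factors_def fam_obj_small[OF Y])

lemma fam_lam_hom: "fam_lam A Y Z m e \<in> hom (Fam (cat M)) A (fam_ihom_obj H P Y Z)"
proof (rule Fam_homI)
  fix i assume i: "i \<in> index A"
  show "imap (fam_lam A Y Z m e) i \<in> index (fam_ihom_obj H P Y Z)"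
    using i by (simp add: fam_lam_def fam_lam_graph)
  show "comps (fam_lam A Y Z m e) i \<in>
      hom (cat M) (fib A i) (fib (fam_ihom_obj H P Y Z) (imap (fam_lam A Y Z m e) i))"
    using tuple_hom[OF fam_obj_small[OF Y] ihom_factors_PiE[OF Y Z fam_lam_graph[OF i]]
        fam_obj_fib[OF A i] fam_lam_factor[OF i]] i
    by (simp add: fam_lam_def fam_lam_graph)
qed (auto simp: fam_lam_def A fam_ihom_obj[OF Y Z])

lemma app_fam_lam: "i \<in> index A \<Longrightarrow> j \<in> index Y \<Longrightarrow> app (imap (fam_lam A Y Z m e) i) j = m i j"
  by (simp add: fam_lam_def fam_obj_small[OF Y])

lemma coord_fam_lam:
  assumes i: "i \<in> index A" and j: "j \<in> index Y"
  shows "coord Y Z (fam_lam A Y Z m e) i j = e i j"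
  using proj_tuple[OF fam_obj_small[OF Y] ihom_factors_PiE[OF Y Z fam_lam_graph[OF i]]
      fam_obj_fib[OF A i] fam_lam_factor[OF i] j] i
  by (simp add: coord_def fam_lam_def)

end

text \<open>Precomposition with \<open>f\<close> moves the index along \<open>imap f\<close>; what
  remains is associativity in the base category.\<close>

lemma coord_Comp:
  assumes Y: "Y \<in> fam_obj (cat M)" and Z: "Z \<in> fam_obj (cat M)"
    and f: "f \<in> hom (Fam (cat M)) A' A" and k: "k \<in> hom (Fam (cat M)) A (fam_ihom_obj H P Y Z)"
    and i: "i \<in> index A'" and j: "j \<in> index Y"
  shows "coord Y Z (Comp (Fam (cat M)) k f) i j =
    Comp (cat M) (coord Y Z k (imap f i) j) (comps f i)"
  using comp_assoc[OF Fam_hom_comps[OF f i] Fam_hom_comps[OF k] proj_ihom_hom[OF Y Z _ j]]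
    Fam_hom_imap[OF f i] Fam_hom_imap[OF k] i
  by (simp add: coord_def Fam_hom_src[OF f])

section \<open>Functoriality of the internal hom in its second argument\<close>

context
  fixes Y Z Z' :: "('v, 'o) fam" and c :: "('v, 'o, 'm) fam_arr"
  assumes Y: "Y \<in> fam_obj (cat M)" and c: "c \<in> hom (Fam (cat M)) Z Z'"
begin

text \<open>A product of arrows is the tuple of the arrows composed with the projections, so the
  coordinates of \<open>[Y, c]\<close> can be read off directly.\<close>

lemma fam_ihom_arr_eq_fam_lam:
  "fam_ihom_arr (cat M) H P Y c =
    fam_lam (fam_ihom_obj H P Y Z) Y Z' (\<lambda>\<alpha> j. imap c (app \<alpha> j))
      (\<lambda>\<alpha> j. Comp (cat M) (onarr (H (fib Y j)) (comps c (app \<alpha> j)))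
        (proj P (index Y) (ihom_factors H Y Z \<alpha>) j))"
  by (auto simp: fam_ihom_arr_def fam_lam_def fam_ihom_imap_def Fam_homD[OF c] o_def
      prod_arr_eq_tuple intro!: restrict_ext)

lemma ihom_map_in: "\<alpha> \<in> index (fam_ihom_obj H P Y Z) \<Longrightarrow> j \<in> index Y \<Longrightarrow> imap c (app \<alpha> j) \<in> index Z'"
  by (auto intro!: Fam_hom_imap[OF c] app_in fam_obj_small[OF Y])

lemma ihom_coord_in:
  assumes "\<alpha> \<in> index (fam_ihom_obj H P Y Z)" "j \<in> index Y"
  shows "Comp (cat M) (onarr (H (fib Y j)) (comps c (app \<alpha> j)))
      (proj P (index Y) (ihom_factors H Y Z \<alpha>) j) \<in>
    hom (cat M) (fib (fam_ihom_obj H P Y Z) \<alpha>) (onobj (H (fib Y j)) (fib Z' (imap c (app \<alpha> j))))"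
  using assms app_in[of \<alpha> "index Y" "index Z" j] fam_obj_small[OF Y]
  by (intro comp_hom[OF proj_ihom_hom[OF Y Fam_hom_dom[OF c]]] H_hom fam_obj_fib[OF Y]
      Fam_hom_comps[OF c]) simp_all

text \<open>These discharge, in order, the five assumptions under which \<open>fam_lam\<close> was
  studied.\<close>

lemmas ihom_lam = fam_ihom_obj[OF Y Fam_hom_dom[OF c]] Y Fam_hom_cod[OF c] ihom_map_in ihom_coord_in

lemma fam_ihom_arr_hom:
  "fam_ihom_arr (cat M) H P Y c \<in> hom (Fam (cat M)) (fam_ihom_obj H P Y Z) (fam_ihom_obj H P Y Z')"
  unfolding fam_ihom_arr_eq_fam_lam by (rule fam_lam_hom[OF ihom_lam])

lemma app_fam_ihom_arr:
  "\<alpha> \<in> fun_set (index Y) (index Z) \<Longrightarrow> j \<in> index Y \<Longrightarrow>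
    app (imap (fam_ihom_arr (cat M) H P Y c) \<alpha>) j = imap c (app \<alpha> j)"
  unfolding fam_ihom_arr_eq_fam_lam by (rule app_fam_lam[OF ihom_lam]) simp_all

lemma coord_fam_ihom_arr:
  "\<alpha> \<in> fun_set (index Y) (index Z) \<Longrightarrow> j \<in> index Y \<Longrightarrow>
    coord Y Z' (fam_ihom_arr (cat M) H P Y c) \<alpha> j =
    Comp (cat M) (onarr (H (fib Y j)) (comps c (app \<alpha> j)))
      (proj P (index Y) (ihom_factors H Y Z \<alpha>) j)"
  unfolding fam_ihom_arr_eq_fam_lam by (rule coord_fam_lam[OF ihom_lam]) simp_all

lemma app_fam_ihom_arr_Comp:
  assumes k: "k \<in> hom (Fam (cat M)) A (fam_ihom_obj H P Y Z)"
    and i: "i \<in> index A" and j: "j \<in> index Y"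
  shows "app (imap (Comp (Fam (cat M)) (fam_ihom_arr (cat M) H P Y c) k) i) j =
    imap c (app (imap k i) j)"
  using Fam_hom_imap[OF k i] i j by (simp add: Fam_hom_src[OF k] app_fam_ihom_arr)

lemma coord_fam_ihom_arr_Comp:
  assumes k: "k \<in> hom (Fam (cat M)) A (fam_ihom_obj H P Y Z)"
    and i: "i \<in> index A" and j: "j \<in> index Y"
  shows "coord Y Z' (Comp (Fam (cat M)) (fam_ihom_arr (cat M) H P Y c) k) i j =
    Comp (cat M) (onarr (H (fib Y j)) (comps c (app (imap k i) j))) (coord Y Z k i j)"
proof -
  note Z = Fam_hom_dom[OF c]
  have ki: "imap k i \<in> fun_set (index Y) (index Z)"
    using Fam_hom_imap[OF k i] by simp
  show ?thesis
    \<comment> \<open>After unfolding, both sides are bracketings of the same three arrows: the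
      component of \<open>k\<close>, a projection, and the image of a component of \<open>c\<close>
      under \<open>H\<close>.\<close>
    unfolding coord_Comp[OF Y Fam_hom_cod[OF c] k fam_ihom_arr_hom i j]
      coord_fam_ihom_arr[OF ki j] coord_def[of Y Z k]
    by (rule comp_assoc[OF Fam_hom_comps[OF k i] proj_ihom_hom[OF Y Z ki j]
          H_hom[OF fam_obj_fib[OF Y j] Fam_hom_comps[OF c app_in[OF ki fam_obj_small[OF Y] j]]],
          symmetric])
qed

end

text \<open>Both sides have the bare projections as coordinates, because each
  \<open>H (fib Y j)\<close> preserves identities.\<close>

lemma fam_ihom_arr_Ident:
  assumes Y: "Y \<in> fam_obj (cat M)" and Z: "Z \<in> fam_obj (cat M)"
  shows "fam_ihom_arr (cat M) H P Y (Ident (Fam (cat M)) Z) =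
    Ident (Fam (cat M)) (fam_ihom_obj H P Y Z)"
proof (rule fam_ihom_eqI[OF Y Z fam_ihom_arr_hom[OF Y Fam_Ident_hom[OF Z]]
      Fam_Ident_hom[OF fam_ihom_obj[OF Y Z]]])
  fix \<alpha> j assume "\<alpha> \<in> index (fam_ihom_obj H P Y Z)" and j: "j \<in> index Y"
  then have \<alpha>: "\<alpha> \<in> fun_set (index Y) (index Z)"
    by simp
  have u: "app \<alpha> j \<in> index Z"
    by (rule app_in[OF \<alpha> fam_obj_small[OF Y] j])
  show "app (imap (fam_ihom_arr (cat M) H P Y (Ident (Fam (cat M)) Z)) \<alpha>) j =
    app (imap (Ident (Fam (cat M)) (fam_ihom_obj H P Y Z)) \<alpha>) j"
    using \<alpha> u by (simp add: app_fam_ihom_arr[OF Y Fam_Ident_hom[OF Z] \<alpha> j])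
  have p: "proj P (index Y) (ihom_factors H Y Z \<alpha>) j \<in>
    hom (cat M) (pobj P (index Y) (ihom_factors H Y Z \<alpha>)) (onobj (H (fib Y j)) (fib Z (app \<alpha> j)))"
    using proj_ihom_hom[OF Y Z \<alpha> j] \<alpha> by simp
  show "coord Y Z (fam_ihom_arr (cat M) H P Y (Ident (Fam (cat M)) Z)) \<alpha> j =
    coord Y Z (Ident (Fam (cat M)) (fam_ihom_obj H P Y Z)) \<alpha> j"
    unfolding coord_fam_ihom_arr[OF Y Fam_Ident_hom[OF Z] \<alpha> j]
    using \<alpha> u by (simp add: coord_def H_ident fam_obj_fib[OF Y j] fam_obj_fib[OF Z u]
        comp_ident_left[OF p] comp_ident_right[OF p])
qed

lemma fam_ihom_arr_Comp:
  assumes Y: "Y \<in> fam_obj (cat M)" and c: "c \<in> hom (Fam (cat M)) Z Z'"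
    and d: "d \<in> hom (Fam (cat M)) Z' Z''"
  shows "fam_ihom_arr (cat M) H P Y (Comp (Fam (cat M)) d c) =
    Comp (Fam (cat M)) (fam_ihom_arr (cat M) H P Y d) (fam_ihom_arr (cat M) H P Y c)"
proof (rule fam_ihom_eqI[OF Y Fam_hom_cod[OF d] fam_ihom_arr_hom[OF Y Fam_Comp_hom[OF c d]]
      Fam_Comp_hom[OF fam_ihom_arr_hom[OF Y c] fam_ihom_arr_hom[OF Y d]]])
  fix \<alpha> j assume \<alpha>': "\<alpha> \<in> index (fam_ihom_obj H P Y Z)" and j: "j \<in> index Y"
  then have \<alpha>: "\<alpha> \<in> fun_set (index Y) (index Z)"
    by simp
  have u: "app \<alpha> j \<in> index Z"
    by (rule app_in[OF \<alpha> fam_obj_small[OF Y] j])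
  show "app (imap (fam_ihom_arr (cat M) H P Y (Comp (Fam (cat M)) d c)) \<alpha>) j =
    app (imap (Comp (Fam (cat M)) (fam_ihom_arr (cat M) H P Y d) (fam_ihom_arr (cat M) H P Y c)) \<alpha>) j"
    unfolding app_fam_ihom_arr[OF Y Fam_Comp_hom[OF c d] \<alpha> j] app_fam_ihom_arr[OF Y c \<alpha> j]
      app_fam_ihom_arr_Comp[OF Y d fam_ihom_arr_hom[OF Y c] \<alpha>' j]
    using u by (simp add: Fam_hom_src[OF c])
  \<comment> \<open>Functoriality of \<open>H (fib Y j)\<close> splits the image of the composite.
    Rebracketing then exposes the coordinate of \<open>[Y, c]\<close>, to which the formula for
    postcomposition with \<open>[Y, d]\<close> applies.\<close>
  have "coord Y Z'' (fam_ihom_arr (cat M) H P Y (Comp (Fam (cat M)) d c)) \<alpha> j =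
    Comp (cat M) (Comp (cat M) (onarr (H (fib Y j)) (comps d (imap c (app \<alpha> j))))
      (onarr (H (fib Y j)) (comps c (app \<alpha> j)))) (proj P (index Y) (ihom_factors H Y Z \<alpha>) j)"
    using u by (simp add: coord_fam_ihom_arr[OF Y Fam_Comp_hom[OF c d] \<alpha> j] Fam_hom_src[OF c]
        H_comp[OF fam_obj_fib[OF Y j] Fam_hom_comps[OF c u]
          Fam_hom_comps[OF d Fam_hom_imap[OF c u]]])
  also have "\<dots> = Comp (cat M) (onarr (H (fib Y j)) (comps d (imap c (app \<alpha> j))))
    (coord Y Z' (fam_ihom_arr (cat M) H P Y c) \<alpha> j)"
    unfolding coord_fam_ihom_arr[OF Y c \<alpha> j]
    by (rule comp_assoc[OF proj_ihom_hom[OF Y Fam_hom_dom[OF c] \<alpha> j]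
          H_hom[OF fam_obj_fib[OF Y j] Fam_hom_comps[OF c u]]
          H_hom[OF fam_obj_fib[OF Y j] Fam_hom_comps[OF d Fam_hom_imap[OF c u]]], symmetric])
  also have "\<dots> = coord Y Z'' (Comp (Fam (cat M)) (fam_ihom_arr (cat M) H P Y d)
    (fam_ihom_arr (cat M) H P Y c)) \<alpha> j"
    by (simp add: coord_fam_ihom_arr_Comp[OF Y d fam_ihom_arr_hom[OF Y c] \<alpha>' j]
        app_fam_ihom_arr[OF Y c \<alpha> j])
  finally show "coord Y Z'' (fam_ihom_arr (cat M) H P Y (Comp (Fam (cat M)) d c)) \<alpha> j =
    coord Y Z'' (Comp (Fam (cat M)) (fam_ihom_arr (cat M) H P Y d)
      (fam_ihom_arr (cat M) H P Y c)) \<alpha> j" .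
qed

lemma cat_functor_Fam_ihom:
  assumes "Y \<in> fam_obj (cat M)"
  shows "cat_functor (Fam (cat M)) (Fam (cat M)) (Fam_ihom (cat M) H P Y)"
  by (intro cat_functor.intro cat_functor_axioms.intro category_Fam)
    (simp_all add: Fam_ihom_def assms fam_ihom_obj fam_ihom_arr_hom fam_ihom_arr_Ident
      fam_ihom_arr_Comp)

section \<open>Tensoring with a family as a functor, and its adjunction with the internal
  hom\<close>

lemma cat_functor_Fam_tensor_right:
  assumes Y: "Y \<in> fam_obj (cat M)"
  shows "cat_functor (Fam (cat M)) (Fam (cat M)) (tensor_right (Fam_monoidal M) Y)"
proof (intro cat_functor.intro cat_functor_axioms.intro category_Fam)
  note id = Fam_Ident_hom[OF Y]
  \<comment> \<open>Interchange needs a composite in both tensor factors, so the identity of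
    \<open>Y\<close> is read as its composite with itself.\<close>
  have id2: "Comp (Fam (cat M)) (Ident (Fam (cat M)) Y) (Ident (Fam (cat M)) Y) = Ident (Fam (cat M)) Y"
    using category.comp_ident_left[OF category_Fam id] .
  show "onarr (tensor_right (Fam_monoidal M) Y) (Comp (Fam (cat M)) g f) =
      Comp (Fam (cat M)) (onarr (tensor_right (Fam_monoidal M) Y) g)
        (onarr (tensor_right (Fam_monoidal M) Y) f)"
    if "f \<in> hom (Fam (cat M)) A B" "g \<in> hom (Fam (cat M)) B C" for f g A B C
    using fam_tens_comp[OF that id id] by (simp add: tensor_right_def id2)
qed (simp_all add: tensor_right_def Y fam_tens_obj fam_tens_arr_hom Fam_Ident_hom fam_tens_ident)

definition fam_curry ::
  "('v, 'o) fam \<Rightarrow> ('v, 'o) fam \<Rightarrow> ('v, 'o) fam \<Rightarrow> ('v, 'o, 'm) fam_arr \<Rightarrow> ('v, 'o, 'm) fam_arr" where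
  "fam_curry Y A B h = fam_lam A Y B (\<lambda>i j. imap h (pair i j))
    (\<lambda>i j. curry (fib Y j) (fib A i) (fib B (imap h (pair i j))) (comps h (pair i j)))"

definition fam_uncurry ::
  "('v, 'o) fam \<Rightarrow> ('v, 'o) fam \<Rightarrow> ('v, 'o) fam \<Rightarrow> ('v, 'o, 'm) fam_arr \<Rightarrow> ('v, 'o, 'm) fam_arr" where
  "fam_uncurry Y A B k =
    \<lparr> src = fam_tens_obj M A Y,
      tgt = B,
      imap = (\<lambda>p \<in> times_set (index A) (index Y). app (imap k (pfst p)) (psnd p)),
      comps = (\<lambda>p \<in> times_set (index A) (index Y).
        uncurry (fib Y (psnd p)) (fib A (pfst p)) (fib B (app (imap k (pfst p)) (psnd p)))
          (coord Y B k (pfst p) (psnd p))) \<rparr>"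

context
  fixes A Y B :: "('v, 'o) fam"
  assumes A: "A \<in> fam_obj (cat M)" and Y: "Y \<in> fam_obj (cat M)" and B: "B \<in> fam_obj (cat M)"
begin

context
  fixes h :: "('v, 'o, 'm) fam_arr"
  assumes h: "h \<in> hom (Fam (cat M)) (fam_tens_obj M A Y) B"
begin

lemma fam_curry_imap_in: "i \<in> index A \<Longrightarrow> j \<in> index Y \<Longrightarrow> imap h (pair i j) \<in> index B"
  using Fam_hom_imap[OF h] by simp

lemma comps_pair_hom:
  "i \<in> index A \<Longrightarrow> j \<in> index Y \<Longrightarrow>
    comps h (pair i j) \<in> hom (cat M) (tens_obj M (fib A i) (fib Y j)) (fib B (imap h (pair i j)))"
  using Fam_hom_comps[OF h, of "pair i j"] by simp

lemma fam_curry_coord_in: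
  "i \<in> index A \<Longrightarrow> j \<in> index Y \<Longrightarrow>
    curry (fib Y j) (fib A i) (fib B (imap h (pair i j))) (comps h (pair i j)) \<in>
    hom (cat M) (fib A i) (onobj (H (fib Y j)) (fib B (imap h (pair i j))))"
  by (intro curry_hom comps_pair_hom fam_obj_fib[OF A] fam_obj_fib[OF Y] fam_obj_fib[OF B]
      fam_curry_imap_in)

lemma fam_curry_hom: "fam_curry Y A B h \<in> hom (Fam (cat M)) A (fam_ihom_obj H P Y B)"
  unfolding fam_curry_def by (rule fam_lam_hom[OF A Y B fam_curry_imap_in fam_curry_coord_in])

lemma app_fam_curry:
  "i \<in> index A \<Longrightarrow> j \<in> index Y \<Longrightarrow> app (imap (fam_curry Y A B h) i) j = imap h (pair i j)"
  unfolding fam_curry_def by (rule app_fam_lam[OF A Y B fam_curry_imap_in fam_curry_coord_in])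

lemma coord_fam_curry:
  "i \<in> index A \<Longrightarrow> j \<in> index Y \<Longrightarrow>
    coord Y B (fam_curry Y A B h) i j =
    curry (fib Y j) (fib A i) (fib B (imap h (pair i j))) (comps h (pair i j))"
  unfolding fam_curry_def by (rule coord_fam_lam[OF A Y B fam_curry_imap_in fam_curry_coord_in])

end

lemma fam_uncurry_hom:
  assumes k: "k \<in> hom (Fam (cat M)) A (fam_ihom_obj H P Y B)"
  shows "fam_uncurry Y A B k \<in> hom (Fam (cat M)) (fam_tens_obj M A Y) B"
proof (rule Fam_homI)
  fix p assume "p \<in> index (fam_tens_obj M A Y)"
  then obtain i j where p: "p = pair i j" and i: "i \<in> index A" and j: "j \<in> index Y"
    by (auto elim: times_setE)
  have u: "app (imap k i) j \<in> index B"
    using app_in[OF _ fam_obj_small[OF Y] j] Fam_hom_imap[OF k i] by simp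
  show "imap (fam_uncurry Y A B k) p \<in> index B"
    using i j u by (simp add: p fam_uncurry_def)
  show "comps (fam_uncurry Y A B k) p \<in>
      hom (cat M) (fib (fam_tens_obj M A Y) p) (fib B (imap (fam_uncurry Y A B k) p))"
    using i j uncurry_hom[OF fam_obj_fib[OF Y j] fam_obj_fib[OF A i] fam_obj_fib[OF B u]
        coord_hom[OF Y B k i j]]
    by (simp add: p fam_uncurry_def)
qed (auto simp: fam_uncurry_def B fam_tens_obj[OF A Y])

text \<open>Arrows out of the tensor product are compared at each \<open>pair i j\<close>; there the
  coordinates of \<open>fam_curry\<close> reduce the claim to \<open>uncurry_curry\<close> in the
  base category.\<close>

lemma fam_uncurry_curry:
  assumes h: "h \<in> hom (Fam (cat M)) (fam_tens_obj M A Y) B"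
  shows "fam_uncurry Y A B (fam_curry Y A B h) = h"
proof (rule Fam_arr_eqI[OF fam_uncurry_hom[OF fam_curry_hom[OF h]] h])
  fix p assume "p \<in> index (fam_tens_obj M A Y)"
  then obtain i j where p: "p = pair i j" and i: "i \<in> index A" and j: "j \<in> index Y"
    by (auto elim: times_setE)
  show "imap (fam_uncurry Y A B (fam_curry Y A B h)) p = imap h p"
    using i j by (simp add: p fam_uncurry_def app_fam_curry[OF h])
  show "comps (fam_uncurry Y A B (fam_curry Y A B h)) p = comps h p"
    using i j by (simp add: p fam_uncurry_def app_fam_curry[OF h] coord_fam_curry[OF h]
        uncurry_curry fam_obj_fib[OF A] fam_obj_fib[OF Y] fam_obj_fib[OF B] fam_curry_imap_in[OF h]
        comps_pair_hom[OF h])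
qed

text \<open>Here the arrows go into \<open>[Y, B]\<close>, so the comparison is by coordinates:
  \<open>app\<close> cancels against \<open>pair\<close> on indices, and
  \<open>curry_uncurry\<close> settles the rest.\<close>

lemma fam_curry_uncurry:
  assumes k: "k \<in> hom (Fam (cat M)) A (fam_ihom_obj H P Y B)"
  shows "fam_curry Y A B (fam_uncurry Y A B k) = k"
proof (rule fam_ihom_eqI[OF Y B fam_curry_hom[OF fam_uncurry_hom[OF k]] k])
  fix i j assume i: "i \<in> index A" and j: "j \<in> index Y"
  have u: "app (imap k i) j \<in> index B"
    using app_in[OF _ fam_obj_small[OF Y] j] Fam_hom_imap[OF k i] by simp
  show "app (imap (fam_curry Y A B (fam_uncurry Y A B k)) i) j = app (imap k i) j"
    unfolding app_fam_curry[OF fam_uncurry_hom[OF k] i j] using i j by (simp add: fam_uncurry_def)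
  show "coord Y B (fam_curry Y A B (fam_uncurry Y A B k)) i j = coord Y B k i j"
    unfolding coord_fam_curry[OF fam_uncurry_hom[OF k] i j]
    using i j by (simp add: fam_uncurry_def curry_uncurry fam_obj_fib[OF A] fam_obj_fib[OF Y] fam_obj_fib[OF B u] coord_hom[OF Y B k])
qed

lemma fam_curry_bij:
  "bij_betw (fam_curry Y A B) (hom (Fam (cat M)) (fam_tens_obj M A Y) B)
    (hom (Fam (cat M)) A (fam_ihom_obj H P Y B))"
  by (rule bij_betw_byWitness[where f' = "fam_uncurry Y A B"])
    (auto simp: fam_uncurry_curry fam_curry_uncurry fam_curry_hom fam_uncurry_hom)

end

text \<open>Naturality is checked on coordinates. At \<open>i\<close> and \<open>j\<close> it
  becomes \<open>curry_natural\<close> for \<open>fib Y j\<close>, applied to the component of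
  \<open>f\<close> at \<open>i\<close> and the components of \<open>h\<close> and \<open>g\<close>
  met along the way.\<close>

lemma fam_curry_natural:
  assumes Y: "Y \<in> fam_obj (cat M)" and f: "f \<in> hom (Fam (cat M)) A' A"
    and g: "g \<in> hom (Fam (cat M)) B B'" and h: "h \<in> hom (Fam (cat M)) (fam_tens_obj M A Y) B"
  shows "fam_curry Y A' B' (Comp (Fam (cat M)) g
      (Comp (Fam (cat M)) h (fam_tens_arr M f (Ident (Fam (cat M)) Y)))) =
    Comp (Fam (cat M)) (fam_ihom_arr (cat M) H P Y g) (Comp (Fam (cat M)) (fam_curry Y A B h) f)"
    (is "fam_curry Y A' B' ?l = Comp _ _ (Comp _ ?k f)")
proof -
  note A = Fam_hom_cod[OF f] and A' = Fam_hom_dom[OF f]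
    and B = Fam_hom_dom[OF g] and B' = Fam_hom_cod[OF g]
  have l: "?l \<in> hom (Fam (cat M)) (fam_tens_obj M A' Y) B'"
    by (rule Fam_Comp_hom[OF Fam_Comp_hom[OF fam_tens_arr_hom[OF f Fam_Ident_hom[OF Y]] h] g])
  note k = fam_curry_hom[OF A Y B h]
  note kf = Fam_Comp_hom[OF f k]
  show ?thesis
  proof (rule fam_ihom_eqI[OF Y B' fam_curry_hom[OF A' Y B' l]
        Fam_Comp_hom[OF kf fam_ihom_arr_hom[OF Y g]]])
    fix i j assume i: "i \<in> index A'" and j: "j \<in> index Y"
    note fi = Fam_hom_imap[OF f i]
    \<comment> \<open>Tensoring \<open>f\<close> with the identity changes only the first entry of
      the index and puts the identity of \<open>fib Y j\<close> in the second factor, which is the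
      shape that \<open>curry_natural\<close> requires.\<close>
    have imap_l: "imap ?l (pair i j) = imap g (imap h (pair (imap f i) j))"
      and comps_l: "comps ?l (pair i j) = Comp (cat M) (comps g (imap h (pair (imap f i) j)))
        (Comp (cat M) (comps h (pair (imap f i) j))
          (tens_arr M (comps f i) (Ident (cat M) (fib Y j))))"
      using i j by (simp_all add: Fam_hom_src[OF f])
    have app_kf: "app (imap (Comp (Fam (cat M)) ?k f) i) j = imap h (pair (imap f i) j)"
      using i by (simp add: Fam_hom_src[OF f] app_fam_curry[OF A Y B h fi j])
    show "app (imap (fam_curry Y A' B' ?l) i) j =
      app (imap (Comp (Fam (cat M)) (fam_ihom_arr (cat M) H P Y g) (Comp (Fam (cat M)) ?k f)) i) j"
      unfolding app_fam_curry[OF A' Y B' l i j] imap_l app_fam_ihom_arr_Comp[OF Y g kf i j] app_kf ..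
    have "coord Y B' (fam_curry Y A' B' ?l) i j =
      curry (fib Y j) (fib A' i) (fib B' (imap g (imap h (pair (imap f i) j)))) (comps ?l (pair i j))"
      unfolding coord_fam_curry[OF A' Y B' l i j] imap_l ..
    also have "\<dots> = Comp (cat M) (onarr (H (fib Y j)) (comps g (imap h (pair (imap f i) j))))
      (Comp (cat M) (curry (fib Y j) (fib A (imap f i)) (fib B (imap h (pair (imap f i) j)))
        (comps h (pair (imap f i) j))) (comps f i))"
      unfolding comps_l
      by (rule curry_natural[OF fam_obj_fib[OF Y j] Fam_hom_comps[OF f i]
            Fam_hom_comps[OF g fam_curry_imap_in[OF A Y B h fi j]]
            comps_pair_hom[OF A Y B h fi j]])
    also have "\<dots> = coord Y B'
      (Comp (Fam (cat M)) (fam_ihom_arr (cat M) H P Y g) (Comp (Fam (cat M)) ?k f)) i j"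
      unfolding coord_fam_ihom_arr_Comp[OF Y g kf i j] app_kf coord_Comp[OF Y B f k i j]
        coord_fam_curry[OF A Y B h fi j] ..
    finally show "coord Y B' (fam_curry Y A' B' ?l) i j = coord Y B'
      (Comp (Fam (cat M)) (fam_ihom_arr (cat M) H P Y g) (Comp (Fam (cat M)) ?k f)) i j" .
  qed
qed

lemma adjunction_Fam:
  assumes Y: "Y \<in> fam_obj (cat M)"
  shows "adjunction (Fam (cat M)) (Fam (cat M)) (tensor_right (Fam_monoidal M) Y)
    (Fam_ihom (cat M) H P Y) (fam_curry Y)"
  by (intro adjunction.intro adjunction_axioms.intro cat_functor_Fam_tensor_right[OF Y]
      cat_functor_Fam_ihom[OF Y])
    (simp_all add: tensor_right_def Fam_ihom_def fam_curry_bij[OF _ Y] fam_curry_natural[OF Y])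

lemma closed_monoidal_category_Fam:
  "closed_monoidal_category (Fam_monoidal M) (Fam_ihom (cat M) H P)"
proof (intro closed_monoidal_category.intro closed_monoidal_category_axioms.intro
    monoidal_category_Fam)
  fix Y :: "('v, 'o) fam" assume "Y \<in> Obj (cat (Fam_monoidal M))"
  then show "is_right_adjoint (cat (Fam_monoidal M)) (cat (Fam_monoidal M))
      (tensor_right (Fam_monoidal M) Y) (Fam_ihom (cat M) H P Y)"
    using adjunction_Fam by (auto simp: is_right_adjoint_def)
qed

end

theorem proposition3p3:
  fixes M :: "('o, 'm) monoidal"
    and H :: "'o \<Rightarrow> ('o, 'm, 'o, 'm) cat_functor"
    and P :: "('v::set_universe, 'o, 'm) products"
  assumes "closed_monoidal_category M H"
    and "complete TYPE('v) (cat M)"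
    and "has_products (cat M) P"
  shows "closed_monoidal_category (Fam_monoidal M) (Fam_ihom (cat M) H P)"
proof -
  interpret closed_monoidal_category M H by fact
  interpret closed_monoidal_with_products M H P
    by unfold_locales fact
  show ?thesis
    by (rule closed_monoidal_category_Fam)
qed

end
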